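(* Let $d\in\mathbb{N}$ and let $c_1,c_2>0$ be constants depending only on $d$. Then there is a constant $C>0$ depending only on $d$ (and on $c_1,c_2$) such that for all $t_1,t\in\mathbb{N}$ with $t_1<t$ and every spherical $t_1$-design $\mathcal{Y}_M=\{y_1,\dots,y_M\}\subset\mathbb{S}^d$ of order $t_1^d$, i.e. with $c_1t_1^d\le M\le c_2t_1^d$, there exist $N\in\mathbb{N}$ with $N+M\le C\,t^{2d+1}$ and a point set $\mathcal{X}_N=\{x_1,\dots,x_N\}\subset\mathbb{S}^d$ such that $\mathcal{X}_N\cup\mathcal{Y}_M$ is a spherical $t$-design.
   Context: $\mathbb{S}^d=\{x\in\mathbb{R}^{d+1}:|x|=1\}$, and $\mu_d$ is the normalized Lebesgue (surface) measure with $\mu_d(\mathbb{S}^d)=1$. Point sets are finite multisets (points may coincide) and unions are multiset unions, so $\mathcal{X}_N\cup\mathcal{Y}_M$ has $N+M$ points counted with multiplicity. For $s\in\mathbb{N}$, a multiset $\{z_1,\dots,z_K\}\subset\mathbb{S}^d$ is a spherical $s$-design if $\int_{\mathbb{S}^d}P\,d\mu_d=\frac1K\sum_{i=1}^K P(z_i)$ for all real polynomials $P$ in $d+1$ variables of degree at most $s$. *)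

theory Defs
  imports "HOL-Analysis.Analysis" "HOL-Library.Poly_Mapping" "HOL-Library.Multiset"
begin

text \<open>
  Real polynomials in variables indexed by \<open>'n\<close>: a monomial is its exponent vector,
  a polynomial maps monomials to coefficients.
\<close>

type_synonym 'n real_mpoly = "('n \<Rightarrow>\<^sub>0 nat) \<Rightarrow>\<^sub>0 real"

definition mpoly_degree :: "('n::finite) real_mpoly \<Rightarrow> nat" where
  "mpoly_degree p =
     Max (insert 0 ((\<lambda>m. \<Sum>i\<in>UNIV. Poly_Mapping.lookup m i) ` Poly_Mapping.keys p))"

definition mpoly_eval :: "('n::finite) real_mpoly \<Rightarrow> real ^ 'n \<Rightarrow> real" where
  "mpoly_eval p x =
     (\<Sum>m\<in>Poly_Mapping.keys p.
        Poly_Mapping.lookup p m * (\<Prod>i\<in>UNIV. (x $ i) ^ Poly_Mapping.lookup m i))"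

text \<open>
  Normalized surface measure: the measure of \<open>A\<close> is the fraction of the unit ball occupied by
  the cone over \<open>A\<close> (see \<open>emeasure_sphere_measure\<close>). It is the rotation-invariant
  probability measure on the unit sphere (\<open>emeasure_sphere_measure_sphere\<close>,
  \<open>emeasure_sphere_measure_orthogonal_image\<close>).
\<close>

definition sphere_measure :: "(real ^ 'n::finite) measure" where
  "sphere_measure =
     restrict_space
       (distr (uniform_measure lborel (ball 0 1)) borel (\<lambda>x. x /\<^sub>R norm x))
       (sphere 0 1)"

definition spherical_design :: "nat \<Rightarrow> (real ^ 'n::finite) multiset \<Rightarrow> bool" where
  "spherical_design s Z \<longleftrightarrow>
     Z \<noteq> {#} \<and> set_mset Z \<subseteq> sphere 0 1 \<and>
     (\<forall>p. mpoly_degree p \<le> s \<longrightarrow>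
        (\<integral>x. mpoly_eval p x \<partial>sphere_measure) = (\<Sum>z\<in>#Z. mpoly_eval p z) / real (size Z))"

lemma space_sphere_measure [simp]: "space (sphere_measure :: (real ^ 'n::finite) measure) = sphere 0 1"
  by (simp add: sphere_measure_def space_restrict_space)

lemma sets_sphere_measure [measurable_cong]:
  "sets (sphere_measure :: (real ^ 'n::finite) measure) = sets (restrict_space borel (sphere 0 1))"
  unfolding sphere_measure_def by (intro sets_restrict_space_cong) simp

lemma emeasure_sphere_measure:
  fixes A :: "(real ^ 'n::finite) set"
  assumes "A \<in> sets borel" "A \<subseteq> sphere 0 1"
  shows "emeasure sphere_measure A =
    emeasure lborel {x \<in> ball 0 1. x /\<^sub>R norm x \<in> A} / emeasure lborel (ball 0 1 :: (real ^ 'n) set)"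
proof -
  have [measurable]: "(\<lambda>x::real^'n. x /\<^sub>R norm x) \<in> borel_measurable borel"
    by measurable
  have m: "(\<lambda>x::real^'n. x /\<^sub>R norm x) -` A \<in> sets borel"
    using measurable_sets[OF \<open>(\<lambda>x. x /\<^sub>R norm x) \<in> borel_measurable borel\<close> assms(1)] by simp
  have eq: "ball 0 1 \<inter> (\<lambda>x::real^'n. x /\<^sub>R norm x) -` A = {x \<in> ball 0 1. x /\<^sub>R norm x \<in> A}"
    by auto
  show ?thesis
    unfolding sphere_measure_def using assms m
    by (subst emeasure_restrict_space) (simp_all add: emeasure_distr eq)
qed

lemma emeasure_sphere_measure_sphere: "emeasure sphere_measure (sphere 0 1 :: (real ^ 'n::finite) set) = 1"
proof -
  let ?B = "ball 0 1 :: (real ^ 'n) set"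
  have pos: "emeasure lborel ?B \<noteq> 0"
    using content_ball_pos[of 1 "0 :: real ^ 'n"] by (auto simp: measure_def)
  have fin: "emeasure lborel ?B \<noteq> \<infinity>"
    using emeasure_lborel_ball_finite by (metis less_irrefl infinity_ennreal_def)
  have "{x \<in> ?B. x /\<^sub>R norm x \<in> sphere 0 1} = ?B - {0}"
    by auto
  moreover have "emeasure lborel (?B - {0}) = emeasure lborel ?B"
    by (rule emeasure_Diff_null_set) auto
  ultimately show ?thesis
    using pos fin by (simp add: emeasure_sphere_measure ennreal_divide_self less_top)
qed

lemma emeasure_lborel_orthogonal_image_open:
  fixes f :: "'a::euclidean_space \<Rightarrow> 'a"
  assumes f: "orthogonal_transformation f" and U: "open U"
  shows "emeasure lborel (f ` U) = emeasure lborel U"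
proof -
  have lin: "linear f" and bij: "bij f"
    using f by (auto intro: orthogonal_transformation_linear orthogonal_transformation_bij)
  have inj: "inj f" using bij by (rule bij_is_inj)
  define K where "K = {(a, r). 0 < r \<and> ball a r \<subseteq> U}"
  have cover: "\<exists>i. i \<in> K \<and> x \<in> ball (fst i) (snd i) \<and> snd i < e"
    if "x \<in> U" "0 < e" for x e
  proof -
    obtain r where r: "r > 0" "ball x r \<subseteq> U"
      using U \<open>x \<in> U\<close> openE by blast
    have "ball x (min r (e / 2)) \<subseteq> U"
      using r(2) by auto
    then show ?thesis
      using r \<open>0 < e\<close> by (intro exI[of _ "(x, min r (e / 2))"]) (auto simp: K_def)
  qed
  obtain C where C: "countable C" "C \<subseteq> K"
    and disj: "pairwise (\<lambda>i j. disjnt (ball (fst i) (snd i)) (ball (fst j) (snd j))) C"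
    and neg: "negligible (U - (\<Union>i\<in>C. ball (fst i) (snd i)))"
    by (rule Vitali_covering_theorem_balls[of U K fst snd]) (use cover in auto)
  define B where "B = (\<Union>i\<in>C. ball (fst i) (snd i))"
  have BU: "B \<subseteq> U" using C(2) by (force simp: B_def K_def)
  have "open B" by (auto simp: B_def)
  have surj: "surj f" using bij by (rule bij_is_surj)
  have open_im: "open (f ` S)" if "open S" for S
    using open_surjective_linear_image[OF that lin surj] .
  have "f differentiable_on (U - B)"
    by (intro linear_imp_differentiable_on lin)
  then have neg': "negligible (f ` (U - B))"
    using neg by (intro negligible_differentiable_image_negligible) (auto simp: B_def)
  have fB: "f ` B = (\<Union>i\<in>C. ball (f (fst i)) (snd i))"
    by (simp add: B_def image_UN image_orthogonal_transformation_ball[OF f])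
  have null: "emeasure lborel V = emeasure lborel W"
    if "W \<subseteq> V" "open V" "open W" "negligible (V - W)" for V W :: "'a set"
  proof -
    have "V - W \<in> null_sets lebesgue"
      using that by (simp add: negligible_iff_null_sets)
    then have "V - W \<in> null_sets lborel"
      using that by (subst (asm) null_sets_completion_iff) auto
    then have "emeasure lborel (V - (V - W)) = emeasure lborel V"
      using that by (intro emeasure_Diff_null_set) auto
    moreover have "V - (V - W) = W"
      using that(1) by blast
    ultimately show ?thesis by simp
  qed
  have "emeasure lborel (f ` U) = emeasure lborel (f ` B)"
    using BU neg' U \<open>open B\<close> inj by (intro null) (auto simp: open_im image_set_diff)
  also have "\<dots> = (\<integral>\<^sup>+ i. emeasure lborel (ball (f (fst i)) (snd i)) \<partial>count_space C)"
    unfolding fB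
  proof (rule emeasure_UN_countable)
    show "disjoint_family_on (\<lambda>i. ball (f (fst i)) (snd i)) C"
      unfolding disjoint_family_on_def
    proof (intro ballI impI)
      fix i j assume "i \<in> C" "j \<in> C" "i \<noteq> j"
      then have "ball (fst i) (snd i) \<inter> ball (fst j) (snd j) = {}"
        using disj by (auto simp: pairwise_def disjnt_def)
      then have "f ` ball (fst i) (snd i) \<inter> f ` ball (fst j) (snd j) = {}"
        using image_Int[OF inj] by (metis image_empty)
      then show "ball (f (fst i)) (snd i) \<inter> ball (f (fst j)) (snd j) = {}"
        by (simp add: image_orthogonal_transformation_ball[OF f])
    qed
  qed (use C in auto)
  also have "\<dots> = (\<integral>\<^sup>+ i. emeasure lborel (ball (fst i) (snd i)) \<partial>count_space C)"
    using C(2) by (intro nn_integral_cong) (auto simp: K_def emeasure_ball)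
  also have "\<dots> = emeasure lborel B"
    unfolding B_def
    by (rule emeasure_UN_countable[symmetric])
      (use C disj in \<open>auto simp: pairwise_def disjnt_def disjoint_family_on_def\<close>)
  also have "\<dots> = emeasure lborel U"
    using BU neg U \<open>open B\<close> by (intro null[symmetric]) (auto simp: B_def)
  finally show ?thesis .
qed

lemma distr_lborel_orthogonal:
  fixes f :: "'a::euclidean_space \<Rightarrow> 'a"
  assumes f: "orthogonal_transformation f"
  shows "distr lborel borel f = lborel"
proof (rule measure_eqI_generator_eq[where E = "{S. open S}" and \<Omega> = UNIV and A = "\<lambda>n. ball 0 (real n)"])
  have bij: "bij f" using f by (rule orthogonal_transformation_bij)
  have meas [measurable]: "f \<in> borel_measurable borel"
    using f by (intro borel_measurable_continuous_onI linear_continuous_on)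
      (simp add: orthogonal_transformation_linear linear_conv_bounded_linear[symmetric])
  show eq: "emeasure (distr lborel borel f) X = emeasure lborel X" if "X \<in> {S. open S}" for X
  proof -
    have "emeasure (distr lborel borel f) X = emeasure lborel (inv f ` X)"
      using that bij by (simp add: emeasure_distr bij_vimage_eq_inv_image)
    then show ?thesis
      using that emeasure_lborel_orthogonal_image_open[OF orthogonal_transformation_inv[OF f]] by simp
  qed
  show "emeasure (distr lborel borel f) (ball 0 (real n)) \<noteq> \<infinity>" for n
    using emeasure_lborel_ball_finite[of "0::'a" "real n"] eq[of "ball 0 (real n)"]
    by (simp add: less_top)
  have "sets (borel :: 'a measure) = sigma_sets UNIV {S. open S}"
    by (simp add: borel_def)
  then show "sets (distr lborel borel f) = sigma_sets UNIV {S. open S}"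
    and "sets lborel = sigma_sets UNIV {S :: 'a set. open S}"
    by simp_all
  show "Int_stable {S :: 'a set. open S}"
    by (simp add: Int_stable_def open_Int)
  show "(\<Union>n. ball (0::'a) (real n)) = UNIV"
    by (auto simp: reals_Archimedean2)
qed auto

lemma emeasure_sphere_measure_orthogonal_image:
  fixes f :: "real ^ 'n::finite \<Rightarrow> real ^ 'n"
  assumes f: "orthogonal_transformation f" and A: "A \<in> sets borel" "A \<subseteq> sphere 0 1"
  shows "emeasure sphere_measure (f ` A) = emeasure sphere_measure A"
proof -
  define g where "g = inv f"
  have g: "orthogonal_transformation g"
    using f by (simp add: g_def orthogonal_transformation_inv)
  have bij: "bij f" using f by (rule orthogonal_transformation_bij)
  have meas: "h \<in> borel_measurable borel" if "orthogonal_transformation h"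
    for h :: "real ^ 'n \<Rightarrow> real ^ 'n"
    using that by (intro borel_measurable_continuous_onI linear_continuous_on)
      (simp add: orthogonal_transformation_linear linear_conv_bounded_linear[symmetric])
  have proj: "(\<lambda>x :: real ^ 'n. x /\<^sub>R norm x) \<in> borel_measurable borel"
    by measurable
  have vim: "g -` A = f ` A"
    using bij by (simp add: g_def bij_vimage_eq_inv_image[OF bij_imp_bij_inv] inv_inv_eq)
  have "g -` A \<inter> space borel \<in> sets borel"
    by (rule measurable_sets[OF meas[OF g] A(1)])
  then have fA1: "f ` A \<in> sets borel"
    by (simp add: vim)
  have fA2: "f ` A \<subseteq> sphere 0 1"
    using A(2) by (auto simp: orthogonal_transformation_norm[OF f])
  define S where "S = {x \<in> ball 0 1. x /\<^sub>R norm x \<in> A}"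
  have S: "S \<in> sets borel"
  proof -
    have "S = ball 0 1 \<inter> ((\<lambda>x. x /\<^sub>R norm x) -` A \<inter> space borel)"
      by (auto simp: S_def)
    also have "\<dots> \<in> sets borel"
      by (intro sets.Int measurable_sets[OF proj A(1)]) auto
    finally show ?thesis .
  qed
  have "{x \<in> ball 0 1. x /\<^sub>R norm x \<in> f ` A} = g -` S"
    unfolding vim[symmetric] S_def vimage_def
    by (simp add: orthogonal_transformation_norm[OF g] orthogonal_transformation_scaleR[OF g])
  also have "emeasure lborel (g -` S) = emeasure (distr lborel borel g) S"
    using S meas[OF g] by (simp add: emeasure_distr)
  also have "\<dots> = emeasure lborel S"
    by (simp add: distr_lborel_orthogonal[OF g])
  finally have "emeasure lborel {x \<in> ball 0 1. x /\<^sub>R norm x \<in> f ` A} = emeasure lborel S" .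
  then show ?thesis
    using A fA1 fA2 by (simp add: emeasure_sphere_measure S_def)
qed

lemma integrable_mpoly_eval:
  "integrable (sphere_measure :: (real ^ 'n::finite) measure) (mpoly_eval p)"
proof -
  interpret finite_measure "sphere_measure :: (real ^ 'n) measure"
    by (rule finite_measureI) (simp add: emeasure_sphere_measure_sphere)
  have cont: "continuous_on S (mpoly_eval p)" for S :: "(real ^ 'n) set"
    unfolding mpoly_eval_def by (intro continuous_intros)
  have "mpoly_eval p \<in> borel_measurable (restrict_space borel (sphere 0 1 :: (real ^ 'n) set))"
    by (intro measurable_restrict_space1 borel_measurable_continuous_onI cont)
  then have meas: "mpoly_eval p \<in> borel_measurable (sphere_measure :: (real ^ 'n) measure)"
    by (simp cong: measurable_cong_sets add: sets_sphere_measure)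
  have "bounded (mpoly_eval p ` (sphere 0 1 :: (real ^ 'n) set))"
    by (intro compact_imp_bounded compact_continuous_image cont compact_sphere)
  then obtain b where "\<forall>x\<in>sphere 0 1 :: (real ^ 'n) set. norm (mpoly_eval p x) \<le> b"
    unfolding bounded_iff by blast
  then show ?thesis
    by (intro integrable_const_bound[where B = b] meas AE_I2) (simp del: mem_sphere_0)
qed

end

theory Submission
  imports Defs "HOL-Homology.Brouwer_Degree"
begin

text \<open>
  Let \<open>W\<close> be the space of functions on the sphere that are given by polynomials of degree at most
  \<open>t\<close> and have mean zero, and let \<open>m\<close> be its dimension; \<open>m \<le> 2 * (t + 1) ^ d\<close>, as the square of one
  coordinate can be eliminated on the sphere (\<open>mean_zero_basis_exists\<close>). A point set is a \<open>t\<close>-design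
  if and only if every \<open>f\<close> in \<open>W\<close> sums to zero over it. The points of \<open>X\<close> are found by a topological
  argument in the style of Kane's construction of small designs on path-connected spaces, with the
  \<open>M\<close> points of \<open>Y\<close> kept fixed.

  For \<open>f\<close> of norm one in \<open>W\<close>, put nearly all of the \<open>N\<close> points of \<open>X\<close> where \<open>f\<close> is close to its minimum
  \<open>- c\<close>. Rotation invariance of \<open>W\<close> bounds its reproducing kernel, which gives \<open>f \<le> m * c\<close>
  (\<open>basis_upper_bound\<close>). If at most \<open>m + 1\<close> points of \<open>X\<close> are not near a minimum, the sum of \<open>f\<close> over
  \<open>X\<close> and \<open>Y\<close> is negative as soon as \<open>N\<close> exceeds a multiple of \<open>m * (m + M)\<close>. If moreover \<open>X\<close> depends
  continuously on \<open>f\<close>, and is defined on the whole unit ball of \<open>W\<close>, then the map taking \<open>f\<close> to the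
  linear form that sums over \<open>X\<close> and \<open>Y\<close> points inward on the boundary of the ball. It therefore has a
  zero (\<open>zero_of_inward_map_on_ball\<close>), and the corresponding \<open>X\<close> is as required.

  In general no choice of minimisers is continuous, and this is why \<open>m + 1\<close> points are given up. The
  ball is triangulated finely by Kuhn's triangulation, and a minimiser is chosen for each vertex. A
  point of the ball lies in the open stars of at most \<open>m + 1\<close> vertices (\<open>card_kuhn_support\<close>), and
  weights on these define a distribution of mass on their minimisers. All minimisers are strung
  along one path in the sphere, and \<open>X\<close> consists of the \<open>N\<close> quantiles of the distribution
  along the path. For each vertex of positive weight, at most one quantile is lost to
  the stretches of path between minimisers (\<open>quantile_positions\<close>).

  As \<open>m\<close> and \<open>M\<close> are of order at most \<open>t ^ d\<close>, the total number of points is of order at most \<open>t ^ (2 * d)\<close>,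
  within the required \<open>t ^ (2 * d + 1)\<close>.
\<close>

section \<open>Zeros of inward pointing maps on a ball\<close>

text \<open>
  If \<open>F\<close> had no zero, the normalised field \<open>- F\<close> would be null-homotopic as a map into the sphere,
  by shrinking the sphere to the centre of the ball. Pointing outward, it is also homotopic to the
  identity, so the sphere would be contractible. Vectors are sequences with finite support because
  the dimension is that of a space of polynomials of variable degree.
\<close>

lemma zero_of_inward_map_on_ball_atMost:
  fixes F :: "(nat \<Rightarrow> real) \<Rightarrow> nat \<Rightarrow> real" and n :: nat
  defines "D \<equiv> {a. (\<Sum>k\<le>n. (a k)\<^sup>2) \<le> 1 \<and> (\<forall>k>n. a k = 0)}"
  assumes cont: "\<And>k. k \<le> n \<Longrightarrow> continuous_on D (\<lambda>a. F a k)"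
    and inward: "\<And>a. a \<in> D \<Longrightarrow> (\<Sum>k\<le>n. (a k)\<^sup>2) = 1 \<Longrightarrow> (\<Sum>k\<le>n. a k * F a k) < 0"
  shows "\<exists>a\<in>D. \<forall>k\<le>n. F a k = 0"
proof (rule ccontr)
  assume no_zero: "\<not> ?thesis"
  define S where "S = {a :: nat \<Rightarrow> real. (\<Sum>k\<le>n. (a k)\<^sup>2) = 1 \<and> (\<forall>k>n. a k = 0)}"
  define q where "q v = (\<Sum>k\<le>n. (v k)\<^sup>2)" for v :: "nat \<Rightarrow> real"
  define nor where "nor v = (\<lambda>k. if k \<le> n then v k / sqrt (q v) else 0)" for v :: "nat \<Rightarrow> real"
  have SD: "S \<subseteq> D" by (auto simp: S_def D_def)
  have q0: "q v \<ge> 0" for v by (simp add: q_def sum_nonneg)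
  have qpos: "q v > 0" if "k \<le> n" "v k \<noteq> 0" for v k
    unfolding q_def using that by (intro sum_pos2[of _ k]) auto
  have nor_S: "nor v \<in> S" if "q v > 0" for v
  proof -
    have "(\<Sum>k\<le>n. (nor v k)\<^sup>2) = (\<Sum>k\<le>n. (v k)\<^sup>2 / q v)"
      using q0 by (intro sum.cong) (auto simp: nor_def power_divide)
    also have "\<dots> = 1"
      using that by (simp add: sum_divide_distrib[symmetric]) (simp add: q_def)
    finally show ?thesis by (simp add: S_def nor_def)
  qed
  have nor_id: "nor a = a" if "a \<in> S" for a
    using that by (auto simp: nor_def S_def q_def)
  have nsphere_eq: "nsphere n = top_of_set S"
    unfolding nsphere S_def euclidean_product_topology ..
  have cont_nor: "continuous_on U (\<lambda>u. nor (f u))"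
    if "\<And>k. k \<le> n \<Longrightarrow> continuous_on U (\<lambda>u. f u k)" "\<And>u. u \<in> U \<Longrightarrow> q (f u) > 0"
    for U :: "(real \<times> (nat \<Rightarrow> real)) set" and f
  proof (rule continuous_on_coordinatewise_then_product)
    fix k
    show "continuous_on U (\<lambda>u. nor (f u) k)"
    proof (cases "k \<le> n")
      case True
      have "continuous_on U (\<lambda>u. q (f u))"
        unfolding q_def by (intro continuous_intros that(1)) auto
      then have "continuous_on U (\<lambda>u. f u k / sqrt (q (f u)))"
        using that(2) by (intro continuous_on_divide that(1) True continuous_on_real_sqrt) force+
      then show ?thesis using True by (simp add: nor_def)
    qed (simp add: nor_def)
  qed
  have cF: "continuous_on U (\<lambda>u. F (g u) k)"
    if "k \<le> n" "continuous_on U g" "g ` U \<subseteq> D" for U :: "(real \<times> (nat \<Rightarrow> real)) set" and g k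
    using continuous_on_compose2[OF cont[OF that(1)] that(2,3)] .
  have coord: "continuous_on U (\<lambda>u :: real \<times> (nat \<Rightarrow> real). snd u k)" for U k
    by (rule continuous_on_product_then_coordinatewise[OF continuous_on_snd[OF continuous_on_id]])
  have cfst: "continuous_on U (fst :: real \<times> (nat \<Rightarrow> real) \<Rightarrow> real)" for U
    by (rule continuous_on_fst[OF continuous_on_id])
  have csnd: "continuous_on U (snd :: real \<times> (nat \<Rightarrow> real) \<Rightarrow> _)" for U
    by (rule continuous_on_snd[OF continuous_on_id])
  define G where "G a = (\<lambda>k. - F a k)" for a
  have qG: "q (G a) > 0" if "a \<in> D" for a
  proof -
    have "\<not> (\<forall>k\<le>n. F a k = 0)" 
      using no_zero bexI[OF _ that, of "\<lambda>a. \<forall>k\<le>n. F a k = 0"] by argo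
    then obtain k where "k \<le> n" "F a k \<noteq> 0" by auto
    then show ?thesis using qpos[of k "G a"] by (simp add: G_def)
  qed
  have homI: "homotopic_with_canon (\<lambda>x. True) S S f g"
    if "continuous_on ({0..1} \<times> S) h" "\<And>u. u \<in> {0..1} \<times> S \<Longrightarrow> h u \<in> S"
      "\<And>x. x \<in> S \<Longrightarrow> h (0, x) = f x" "\<And>x. x \<in> S \<Longrightarrow> h (1, x) = g x"
    for f g and h :: "real \<times> (nat \<Rightarrow> real) \<Rightarrow> nat \<Rightarrow> real"
  proof -
    have "h \<in> {0..1} \<times> S \<rightarrow> S" using that(2) by blast
    with that show ?thesis
      by - (rule homotopic_with[THEN iffD2], rule refl, rule exI[of _ h],
          simp add: prod_topology_subtopology_eu)
  qed
  \<comment> \<open>On the sphere the identity is homotopic to the normalised field \<open>G\<close>, since they are never opposite.\<close>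
  let ?h = "\<lambda>u :: real \<times> (nat \<Rightarrow> real). \<lambda>k. (1 - fst u) * snd u k + fst u * G (snd u) k"
  have pos: "q (?h u) > 0" if u: "u \<in> {0..1} \<times> S" for u
  proof (rule ccontr)
    assume *: "\<not> q (?h u) > 0"
    have z: "?h u k = 0" if "k \<le> n" for k
      using qpos[OF that, of "?h u"] * by argo
    obtain s a where sa: "u = (s, a)" "0 \<le> s" "s \<le> 1" "a \<in> S" using u by auto
    have "0 = (\<Sum>k\<le>n. a k * ?h u k)" by (simp add: z)
    also have "\<dots> = (\<Sum>k\<le>n. (1 - s) * (a k)\<^sup>2 - s * (a k * F a k))"
      by (intro sum.cong) (simp_all add: sa(1) G_def algebra_simps power2_eq_square)
    also have "\<dots> = (1 - s) * (\<Sum>k\<le>n. (a k)\<^sup>2) - s * (\<Sum>k\<le>n. a k * F a k)"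
      by (simp add: sum_subtractf sum_distrib_left)
    also have "\<dots> = (1 - s) + s * (- (\<Sum>k\<le>n. a k * F a k))"
      using sa(4) by (simp add: S_def)
    finally have eq: "(1 - s) + s * (- (\<Sum>k\<le>n. a k * F a k)) = 0" ..
    have "(\<Sum>k\<le>n. a k * F a k) < 0" using inward[of a] sa(4) SD by (auto simp: S_def)
    then have "s * (- (\<Sum>k\<le>n. a k * F a k)) > 0" if "s > 0"
      using that by (intro mult_pos_pos) auto
    then show False using eq sa(2,3) by (cases "s = 0") auto
  qed
  have "continuous_on ({0..1} \<times> S) (\<lambda>u. nor (?h u))"
  proof (rule cont_nor)
    show "continuous_on ({0..1} \<times> S) (\<lambda>u. ?h u k)" if "k \<le> n" for k
      unfolding G_def using SD
      by (intro continuous_on_add continuous_on_mult continuous_on_diff continuous_on_const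
          continuous_on_minus coord cfst csnd cF[OF that]) auto
  qed (rule pos)
  then have hom1: "homotopic_with_canon (\<lambda>x. True) S S id (\<lambda>a. nor (G a))"
    by (rule homI) (simp_all only: pos nor_S, simp_all add: nor_id)
  \<comment> \<open>The field extends over the ball without zeros, hence is null-homotopic.\<close>
  let ?g = "\<lambda>u :: real \<times> (nat \<Rightarrow> real). \<lambda>k. (1 - fst u) * snd u k"
  have g: "?g u \<in> D" if "u \<in> {0..1} \<times> S" for u
  proof -
    have "(\<Sum>k\<le>n. (?g u k)\<^sup>2) = (1 - fst u)\<^sup>2 * (\<Sum>k\<le>n. (snd u k)\<^sup>2)"
      by (simp add: power_mult_distrib sum_distrib_left)
    also have "\<dots> \<le> 1" using that by (auto simp: S_def power_le_one)
    finally show ?thesis using that by (auto simp: D_def S_def)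
  qed
  have "continuous_on ({0..1} \<times> S) (\<lambda>u. nor (G (?g u)))"
  proof (rule cont_nor)
    show "continuous_on ({0..1} \<times> S) (\<lambda>u. G (?g u) k)" if "k \<le> n" for k
      unfolding G_def using g
      by (intro continuous_on_minus cF[OF that] continuous_on_coordinatewise_then_product
          continuous_on_mult continuous_on_diff continuous_on_const coord cfst) auto
    show "q (G (?g u)) > 0" if "u \<in> {0..1} \<times> S" for u
      using qG[OF g[OF that]] .
  qed
  then have hom2: "homotopic_with_canon (\<lambda>x. True) S S (\<lambda>a. nor (G a)) (\<lambda>a. nor (G (\<lambda>k. 0)))"
  proof (rule homI)
    show "nor (G (?g u)) \<in> S" if "u \<in> {0..1} \<times> S" for u
      using nor_S[OF qG[OF g[OF that]]] .
  qed simp_all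
  have "contractible_space (nsphere n)"
    unfolding contractible_space_def nsphere_eq
    by (rule exI[of _ "nor (G (\<lambda>k. 0))"], rule homotopic_with_trans[OF hom1 hom2])
  then show False using non_contractible_space_nsphere by blast
qed

corollary zero_of_inward_map_on_ball:
  fixes F :: "(nat \<Rightarrow> real) \<Rightarrow> nat \<Rightarrow> real" and m :: nat
  defines "D \<equiv> {a. (\<Sum>k<m. (a k)\<^sup>2) \<le> 1 \<and> (\<forall>k\<ge>m. a k = 0)}"
  assumes "m > 0"
    and "\<And>k. k < m \<Longrightarrow> continuous_on D (\<lambda>a. F a k)"
    and "\<And>a. a \<in> D \<Longrightarrow> (\<Sum>k<m. (a k)\<^sup>2) = 1 \<Longrightarrow> (\<Sum>k<m. a k * F a k) < 0"
  shows "\<exists>a\<in>D. \<forall>k<m. F a k = 0"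
proof -
  obtain n where n: "m = Suc n" using \<open>m > 0\<close> gr0_conv_Suc by blast
  have "{..<m} = {..n}" "\<And>k. k < m \<longleftrightarrow> k \<le> n" "\<And>k. k \<ge> m \<longleftrightarrow> k > n"
    by (auto simp: n)
  note eqs = this
  show ?thesis
    using assms(3,4) unfolding D_def eqs by (rule zero_of_inward_map_on_ball_atMost)
qed

section \<open>Distributing points along a path\<close>

text \<open>
  Place mass \<open>w l\<close> at position \<open>l\<close> of the line and cut the total mass, from left to right, into \<open>N\<close>
  equal blocks. The \<open>i\<close>-th block is represented by one point, whose position \<open>pos i\<close> depends
  continuously on \<open>w\<close>: the summand for \<open>k\<close> is the fraction of the block to the right of the gap between
  the positions \<open>k - 1\<close> and \<open>k\<close>. A block that lies inside a single atom is represented by that atom.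
  Any other block contains the right end of an atom in its interior, and distinct blocks contain
  distinct such ends, so at most one block is lost for each atom of positive mass.
\<close>

lemma quantile_positions:
  fixes w :: "nat \<Rightarrow> real" and n N :: nat
  defines "pos \<equiv> \<lambda>i. \<Sum>k\<in>{1..<n}. min 1 (max 0 (real i + 1 - real N * (\<Sum>l<k. w l)))"
  assumes w0: "\<And>l. w l \<ge> 0" and w1: "(\<Sum>l<n. w l) = 1"
  shows "\<exists>B\<subseteq>{..<N}. card B \<le> card {l. l < n \<and> w l > 0} \<and>
           (\<forall>i\<in>{..<N} - B. \<exists>l<n. w l > 0 \<and> pos i = real l)"
proof -
  define W where "W k = real N * (\<Sum>l<k. w l)" for k
  \<comment> \<open>The atom in which block \<open>i\<close> begins, and the blocks that are cut by a gap.\<close>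
  define lo where "lo i = (LEAST l. W (Suc l) > real i)" for i :: nat
  define B where "B = {i. i < N \<and> (\<exists>k\<in>{1..<n}. real i < W k \<and> W k < real i + 1)}"
  have "n \<noteq> 0" using w1 by (cases n) auto
  then obtain n' where n': "n = Suc n'" by (cases n) auto
  have mono: "W k \<le> W l" if "k \<le> l" for k l
    unfolding W_def using that w0 by (intro mult_left_mono sum_mono2) auto
  have Wn: "W n = real N" by (simp add: W_def w1)
  have lo: "W (Suc (lo i)) > real i" "lo i < n" "W (lo i) \<le> real i" "w (lo i) > 0"
    if "i < N" for i
  proof -
    have *: "W (Suc n') > real i" using that Wn n' by simp
    show 1: "W (Suc (lo i)) > real i"
      unfolding lo_def by (rule LeastI[where P = "\<lambda>l. W (Suc l) > real i", OF *])
    have "lo i \<le> n'" unfolding lo_def by (rule Least_le[where P = "\<lambda>l. W (Suc l) > real i", OF *])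
    then show "lo i < n" by (simp add: n')
    show 2: "W (lo i) \<le> real i"
    proof (cases "lo i")
      case (Suc j)
      then have "\<not> W (Suc j) > real i"
        by (intro not_less_Least[where P = "\<lambda>l. W (Suc l) > real i"]) (simp add: lo_def)
      then show ?thesis using Suc by simp
    qed (simp add: W_def)
    have "W (Suc (lo i)) - W (lo i) = real N * w (lo i)"
      by (simp add: W_def algebra_simps)
    then have "real N * w (lo i) > 0" using 1 2 by linarith
    then show "w (lo i) > 0" by (simp add: zero_less_mult_iff)
  qed
  have inj: "inj_on lo B"
  proof (rule linorder_inj_onI)
    fix i j assume ij: "i < j" "i \<in> B" "j \<in> B"
    obtain k where k: "k \<in> {1..<n}" "real i < W k" "W k < real i + 1" and iN: "i < N"
      using ij(2) by (auto simp: B_def)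
    obtain k' where k': "k = Suc k'" using k(1) by (cases k) auto
    have "lo i \<le> k'"
      unfolding lo_def by (rule Least_le) (use k k' in simp)
    then have "W (Suc (lo i)) < real i + 1" using mono[of "Suc (lo i)" k] k k' by simp
    moreover have "W (Suc (lo j)) > real j" using lo(1)[of j] ij by (simp add: B_def)
    moreover have "real i + 1 \<le> real j" using ij(1) by simp
    ultimately show "lo i \<noteq> lo j" by auto
  qed auto
  have "card B \<le> card {l. l < n \<and> w l > 0}"
    using lo by (intro card_inj_on_le[OF inj]) (auto simp: B_def)
  moreover have "\<exists>l<n. w l > 0 \<and> pos i = real l" if i: "i \<in> {..<N} - B" for i
  proof (intro exI conjI)
    have iN: "i < N" using i by simp
    show "lo i < n" "w (lo i) > 0" using lo[OF iN] by auto
    have "min 1 (max 0 (real i + 1 - W k)) = (if k \<le> lo i then 1 else 0)" if k: "k \<in> {1..<n}" for k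
    proof (cases "k \<le> lo i")
      case True
      then show ?thesis using mono[OF True] lo(3)[OF iN] by simp
    next
      case False
      then have "W k > real i" using mono[of "Suc (lo i)" k] lo(1)[OF iN] by simp
      moreover have "\<not> (real i < W k \<and> W k < real i + 1)"
        using i k by (auto simp: B_def)
      ultimately show ?thesis using False by simp
    qed
    then have "pos i = (\<Sum>k\<in>{1..<n}. if k \<le> lo i then 1 else 0)"
      unfolding pos_def W_def by (intro sum.cong) auto
    also have "\<dots> = real (card ({1..<n} \<inter> {k. k \<le> lo i}))"
      by (simp add: sum.If_cases)
    also have "{1..<n} \<inter> {k. k \<le> lo i} = {1..lo i}" using lo(2)[OF iN] by auto
    finally show "pos i = real (lo i)" by simp
  qed
  ultimately show ?thesis by (intro exI[of _ B]) (auto simp: B_def)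
qed

text \<open>
  A configuration of points on one path through all the points \<open>p j\<close> can be described by positions
  in an interval, so it can be varied continuously even though the points \<open>p j\<close> jump.
\<close>

lemma path_through_points:
  fixes p :: "nat \<Rightarrow> 'a::topological_space"
  assumes S: "path_connected S" and p: "\<And>j. p j \<in> S"
  shows "\<exists>\<gamma>. continuous_on {0..real n} \<gamma> \<and> \<gamma> ` {0..real n} \<subseteq> S \<and> (\<forall>j\<le>n. \<gamma> (real j) = p j)"
proof (induction n)
  case 0
  show ?case using p by (intro exI[of _ "\<lambda>_. p 0"]) auto
next
  case (Suc n)
  then obtain \<gamma> where \<gamma>: "continuous_on {0..real n} \<gamma>" "\<gamma> ` {0..real n} \<subseteq> S"
    "\<And>j. j \<le> n \<Longrightarrow> \<gamma> (real j) = p j" by blast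
  obtain q where q: "path q" "path_image q \<subseteq> S" "pathstart q = p n" "pathfinish q = p (Suc n)"
    using S p unfolding path_connected_def by metis
  let ?g = "\<lambda>s. if s \<le> real n then \<gamma> s else q (s - real n)"
  have "continuous_on {0..real (Suc n)} ?g"
  proof (rule continuous_on_cases_le)
    show "continuous_on {s \<in> {0..real (Suc n)}. s \<le> real n} \<gamma>"
      by (rule continuous_on_subset[OF \<gamma>(1)]) auto
    show "continuous_on {s \<in> {0..real (Suc n)}. real n \<le> s} (\<lambda>s. q (s - real n))"
      by (rule continuous_on_compose2[OF q(1)[unfolded path_def]]) (auto intro!: continuous_intros)
    show "\<gamma> s = q (s - real n)" if "s = real n" for s
      using that \<gamma>(3)[of n] q(3) by (simp add: pathstart_def)
  qed (auto intro: continuous_intros)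
  moreover have "?g ` {0..real (Suc n)} \<subseteq> S"
    using \<gamma>(2) q(2) by (auto simp: path_image_def image_subset_iff)
  moreover have "?g (real j) = p j" if "j \<le> Suc n" for j
    using that \<gamma>(3)[of j] q(4) by (cases "j = Suc n") (auto simp: pathfinish_def)
  ultimately show ?case by blast
qed

section \<open>Kuhn's triangulation\<close>

text \<open>
  The integer lattice is the vertex set of Kuhn's triangulation of \<open>\<real>\<^sup>m\<close>, and the weight is positive
  exactly on the open star of the origin. Normalised translates of it therefore replace barycentric
  coordinates; the product form makes continuity evident.
\<close>

definition kuhn_weight :: "nat \<Rightarrow> (nat \<Rightarrow> real) \<Rightarrow> real" where
  "kuhn_weight m u =
     (\<Prod>k<m. max 0 (1 - \<bar>u k\<bar>)) * (\<Prod>k<m. \<Prod>l<m. max 0 (1 - (u k - u l)))"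

lemma kuhn_weight_nonneg: "kuhn_weight m u \<ge> 0"
  unfolding kuhn_weight_def by (intro mult_nonneg_nonneg prod_nonneg) auto

lemma kuhn_weight_pos_iff:
  "kuhn_weight m u > 0 \<longleftrightarrow> (\<forall>k<m. \<bar>u k\<bar> < 1) \<and> (\<forall>k<m. \<forall>l<m. u k - u l < 1)"
proof -
  have zero_iff: "max 0 (1 - z) = 0 \<longleftrightarrow> z \<ge> 1" for z :: real
    by auto
  have "kuhn_weight m u > 0 \<longleftrightarrow> kuhn_weight m u \<noteq> 0"
    using kuhn_weight_nonneg[of m u] by auto
  also have "\<dots> \<longleftrightarrow> (\<forall>k<m. \<bar>u k\<bar> < 1) \<and> (\<forall>k<m. \<forall>l<m. u k - u l < 1)"
    using zero_iff by (fastforce simp: kuhn_weight_def not_le)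
  finally show ?thesis .
qed

lemma kuhn_weight_floor_pos: "kuhn_weight m (\<lambda>k. x k - real_of_int \<lfloor>x k\<rfloor>) > 0"
  unfolding kuhn_weight_pos_iff by (auto; linarith)

text \<open>
  The lattice points whose stars contain a given point are the vertices of one simplex: they are
  pairwise comparable and differ by at most one in each coordinate, so the coordinate sum maps them
  injectively into an interval of \<open>m + 1\<close> integers.
\<close>

lemma card_kuhn_support:
  fixes V :: "(nat \<Rightarrow> int) set"
  assumes fin: "finite V" and zero: "\<And>v k. v \<in> V \<Longrightarrow> k \<ge> m \<Longrightarrow> v k = 0"
    and pos: "\<And>v. v \<in> V \<Longrightarrow> kuhn_weight m (\<lambda>k. x k - real_of_int (v k)) > 0"
  shows "card V \<le> m + 1"
proof (cases "V = {}")
  case False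
  define s where "s v = (\<Sum>k<m. v k)" for v :: "nat \<Rightarrow> int"
  have near: "\<bar>x k - v k\<bar> < 1" if "v \<in> V" "k < m" for v k
    using pos[OF that(1)] that(2) by (auto simp: kuhn_weight_pos_iff)
  have pair: "(x k - v k) - (x l - v l) < 1" if "v \<in> V" "k < m" "l < m" for v k l
    using pos[OF that(1)] that(2,3) by (auto simp: kuhn_weight_pos_iff)
  have chain: "(\<forall>k<m. v k \<le> v' k) \<or> (\<forall>k<m. v' k \<le> v k)" if "v \<in> V" "v' \<in> V" for v v'
  proof (rule ccontr)
    assume "\<not> ?thesis"
    then obtain i j where ij: "i < m" "j < m" "v' i < v i" "v j < v' j"
      by (auto simp: not_le)
    have "real_of_int (v' i) + 1 \<le> v i" "real_of_int (v j) + 1 \<le> v' j" using ij by linarith+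
    then show False using pair[OF that(1) ij(2,1)] pair[OF that(2) ij(1,2)] by linarith
  qed
  have eqI: "v = v'" if "v \<in> V" "v' \<in> V" "s v = s v'" "\<forall>k<m. v k \<le> v' k" for v v'
  proof
    fix k
    show "v k = v' k"
    proof (cases "k < m")
      case True
      then show ?thesis
        using that(3,4) sum_mono_inv[of v "{..<m}" v' k] by (auto simp: s_def)
    qed (use zero[of v k] zero[of v' k] that(1,2) in simp)
  qed
  have inj: "inj_on s V"
    by (rule inj_onI) (metis chain eqI)
  obtain v0 where v0: "v0 \<in> V" "\<And>v. v \<in> V \<Longrightarrow> s v0 \<le> s v"
    using ex_is_arg_min_if_finite[OF fin False, of s] by (auto simp: is_arg_min_linorder)
  have "s v \<le> s v0 + int m" if "v \<in> V" for v
  proof -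
    have "v k \<le> v0 k + 1" if "k < m" for k
      using near[OF v0(1) that] near[OF \<open>v \<in> V\<close> that] by linarith
    then have "s v \<le> (\<Sum>k<m. v0 k + 1)" unfolding s_def by (intro sum_mono) auto
    then show ?thesis by (simp add: s_def sum.distrib)
  qed
  then have "s ` V \<subseteq> {s v0..s v0 + int m}" using v0 by auto
  then have "card (s ` V) \<le> card {s v0..s v0 + int m}" by (intro card_mono) auto
  then show ?thesis using card_image[OF inj] by simp
qed simp

section \<open>Polynomial functions on the sphere\<close>

text \<open>
  Polynomial functions of degree at most \<open>t\<close>. Closure under products is a consequence; taking
  multiplication by a coordinate as the only multiplicative rule keeps the inductions short.
\<close>

inductive poly_fun :: "nat \<Rightarrow> (real ^ 'n::finite \<Rightarrow> real) \<Rightarrow> bool" where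
  const: "poly_fun t (\<lambda>x. c)"
| add: "poly_fun t f \<Longrightarrow> poly_fun t g \<Longrightarrow> poly_fun t (\<lambda>x. f x + g x)"
| coord: "poly_fun t f \<Longrightarrow> poly_fun (Suc t) (\<lambda>x. x $ i * f x)"
| up: "poly_fun t f \<Longrightarrow> poly_fun (Suc t) f"

lemma poly_fun_mono: "poly_fun s f \<Longrightarrow> s \<le> t \<Longrightarrow> poly_fun t f"
  by (induction t) (auto intro: poly_fun.up simp: le_Suc_eq)

lemma poly_fun_cmult: "poly_fun t f \<Longrightarrow> poly_fun t (\<lambda>x. c * f x)"
proof (induction rule: poly_fun.induct)
  case (add t f g)
  then show ?case using poly_fun.add[of t "\<lambda>x. c * f x" "\<lambda>x. c * g x"] by (simp add: distrib_left)
next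
  case (coord t f i)
  then show ?case using poly_fun.coord[of t "\<lambda>x. c * f x" i] by (simp add: mult.left_commute)
qed (auto intro: poly_fun.intros)

lemma poly_fun_sum:
  "(\<And>a. a \<in> A \<Longrightarrow> poly_fun t (f a)) \<Longrightarrow> poly_fun t (\<lambda>x. \<Sum>a\<in>A. f a x)"
  by (induction A rule: infinite_finite_induct) (auto intro: poly_fun.intros)

lemma poly_fun_mult: "poly_fun s f \<Longrightarrow> poly_fun t g \<Longrightarrow> poly_fun (s + t) (\<lambda>x. f x * g x)"
proof (induction rule: poly_fun.induct)
  case (const s c)
  then show ?case by (intro poly_fun_cmult, elim poly_fun_mono) simp
next
  case (add s f h)
  then show ?case using poly_fun.add[of "s + t" "\<lambda>x. f x * g x" "\<lambda>x. h x * g x"]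
    by (simp add: distrib_right)
next
  case (coord s f i)
  then show ?case using poly_fun.coord[of "s + t" "\<lambda>x. f x * g x" i] by (simp add: mult.assoc)
qed (auto intro: poly_fun.intros)

lemma poly_fun_monomial:
  "poly_fun (\<Sum>i\<in>A. e i) (\<lambda>x :: real ^ 'n::finite. \<Prod>i\<in>A. (x $ i) ^ e i)"
proof -
  have pow: "poly_fun k (\<lambda>x :: real ^ 'n. (x $ i) ^ k)" for i k
    by (induction k) (auto intro: poly_fun.intros)
  show ?thesis
    by (induction A rule: infinite_finite_induct) (auto intro: poly_fun.intros poly_fun_mult pow)
qed

lemma poly_fun_mpoly_eval:
  assumes "mpoly_degree p \<le> t"
  shows "poly_fun t (mpoly_eval p)"
  unfolding mpoly_eval_def
proof (rule poly_fun_sum, rule poly_fun_cmult)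
  fix m assume "m \<in> Poly_Mapping.keys p"
  then have "(\<Sum>i\<in>UNIV. Poly_Mapping.lookup m i) \<le> mpoly_degree p"
    unfolding mpoly_degree_def by (intro Max_ge) auto
  then show "poly_fun t (\<lambda>x. \<Prod>i\<in>UNIV. (x $ i) ^ Poly_Mapping.lookup m i)"
    using assms by (intro poly_fun_mono[OF poly_fun_monomial]) simp
qed

lemma poly_fun_continuous: "poly_fun t f \<Longrightarrow> continuous_on S f"
  by (induction rule: poly_fun.induct) (auto intro!: continuous_intros)

lemma poly_fun_linear_comp:
  assumes T: "linear T"
  shows "poly_fun t f \<Longrightarrow> poly_fun t (\<lambda>x. f (T x))"
proof (induction rule: poly_fun.induct)
  case (coord t f i)
  have "T x $ i * f (T x) = (\<Sum>j\<in>UNIV. (matrix T $ i $ j) * (x $ j * f (T x)))" for x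
  proof -
    have "T x = matrix T *v x" by (simp add: T)
    then have "T x $ i = (\<Sum>j\<in>UNIV. matrix T $ i $ j * x $ j)"
      by (simp only: matrix_vector_mult_def vec_lambda_beta)
    then show ?thesis by (simp add: sum_distrib_right mult.assoc)
  qed
  moreover have "poly_fun (Suc t) (\<lambda>x. \<Sum>j\<in>UNIV. (matrix T $ i $ j) * (x $ j * f (T x)))"
    by (intro poly_fun_sum poly_fun_cmult poly_fun.coord coord.IH)
  ultimately show ?case by simp
qed (auto intro: poly_fun.intros)

definition monomial_fun :: "('n::finite \<Rightarrow> nat) \<Rightarrow> real ^ 'n \<Rightarrow> real" where
  "monomial_fun e x = (\<Prod>i\<in>UNIV. (x $ i) ^ e i)"

text \<open>
  On the sphere, the square of the \<open>j\<close>-th coordinate can be eliminated. Only monomials in which it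
  occurs at most linearly remain, and their number is of order \<open>t ^ (CARD('n) - 1)\<close> instead of
  \<open>t ^ CARD('n)\<close>. This is what makes the number of points depend on \<open>d\<close> rather than \<open>d + 1\<close>.
\<close>

definition reduced_exponents :: "'n::finite \<Rightarrow> nat \<Rightarrow> ('n \<Rightarrow> nat) set" where
  "reduced_exponents j t = {e. e j \<le> 1 \<and> (\<Sum>i\<in>UNIV. e i) \<le> t}"

lemma reduced_exponents_finite_card:
  fixes j :: "'n::finite"
  shows "finite (reduced_exponents j t)"
    and "card (reduced_exponents j t) \<le> 2 * (t + 1) ^ (CARD('n) - 1)"
proof -
  let ?P = "PiE UNIV (\<lambda>i. if i = j then {..1} else {..t}) :: ('n \<Rightarrow> nat) set"
  have sub: "reduced_exponents j t \<subseteq> ?P"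
  proof
    fix e :: "'n \<Rightarrow> nat" assume e: "e \<in> reduced_exponents j t"
    have "e i \<le> (\<Sum>i\<in>UNIV. e i)" for i by (rule member_le_sum) auto
    then have "e i \<le> t" for i
      using e le_trans by (fastforce simp: reduced_exponents_def)
    then show "e \<in> ?P" using e by (auto simp: reduced_exponents_def)
  qed
  have fin: "finite ?P" by (intro finite_PiE) auto
  show "finite (reduced_exponents j t)" using sub fin by (rule finite_subset)
  have "card ?P = (\<Prod>i\<in>UNIV. if i = j then 2 else t + 1)"
    by (subst card_PiE) (auto intro!: prod.cong)
  also have "\<dots> = 2 * (\<Prod>i\<in>UNIV - {j}. t + 1)"
    by (subst prod.remove[of _ j]) (auto intro!: prod.cong)
  also have "\<dots> = 2 * (t + 1) ^ (CARD('n) - 1)"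
    by (simp add: card_Diff_singleton)
  finally show "card (reduced_exponents j t) \<le> 2 * (t + 1) ^ (CARD('n) - 1)"
    using card_mono[OF fin sub] by simp
qed

lemma exponent_shift:
  "monomial_fun (e(i := e i + k)) x = (x $ i) ^ k * monomial_fun e x"
  "(\<Sum>l\<in>UNIV. (e(i := e i + k)) l) = (\<Sum>l\<in>UNIV. e l) + (k :: nat)" for i :: "'n::finite"
proof -
  have "monomial_fun (e(i := e i + k)) x = (x $ i) ^ (e i + k) * (\<Prod>l\<in>UNIV - {i}. (x $ l) ^ e l)"
    unfolding monomial_fun_def by (subst prod.remove[of _ i]) auto
  also have "\<dots> = (x $ i) ^ k * monomial_fun e x"
    unfolding monomial_fun_def by (subst (2) prod.remove[of _ i]) (auto simp: power_add)
  finally show "monomial_fun (e(i := e i + k)) x = (x $ i) ^ k * monomial_fun e x" .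
  have "(\<Sum>l\<in>UNIV. (e(i := e i + k)) l) = (e i + k) + (\<Sum>l\<in>UNIV - {i}. e l)"
    by (subst sum.remove[of _ i]) auto
  then show "(\<Sum>l\<in>UNIV. (e(i := e i + k)) l) = (\<Sum>l\<in>UNIV. e l) + k"
    by (simp add: sum.remove[of UNIV i e])
qed

definition reduced_on_sphere :: "'n::finite \<Rightarrow> nat \<Rightarrow> (real ^ 'n \<Rightarrow> real) \<Rightarrow> bool" where
  "reduced_on_sphere j t f \<longleftrightarrow>
     (\<exists>c. \<forall>x\<in>sphere 0 1. f x = (\<Sum>e\<in>reduced_exponents j t. c e * monomial_fun e x))"

lemma reduced_on_sphere_monomial:
  assumes "e \<in> reduced_exponents j t" shows "reduced_on_sphere j t (monomial_fun e)"
  unfolding reduced_on_sphere_def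
  using assms reduced_exponents_finite_card(1)[of j t]
  by (intro exI[of _ "\<lambda>e'. if e' = e then 1 else 0"]) (simp add: if_distrib[of "\<lambda>c. c * _"] cong: if_cong)

lemma reduced_on_sphere_add:
  assumes "reduced_on_sphere j t f" "reduced_on_sphere j t g"
  shows "reduced_on_sphere j t (\<lambda>x. f x + g x)"
proof -
  obtain b c where "\<forall>x\<in>sphere 0 1. f x = (\<Sum>e\<in>reduced_exponents j t. b e * monomial_fun e x)"
    "\<forall>x\<in>sphere 0 1. g x = (\<Sum>e\<in>reduced_exponents j t. c e * monomial_fun e x)"
    using assms unfolding reduced_on_sphere_def by blast
  then show ?thesis unfolding reduced_on_sphere_def
    by (intro exI[of _ "\<lambda>e. b e + c e"]) (simp add: distrib_right sum.distrib)
qed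

lemma reduced_on_sphere_cmult:
  assumes "reduced_on_sphere j t f"
  shows "reduced_on_sphere j t (\<lambda>x. a * f x)"
proof -
  obtain b where "\<forall>x\<in>sphere 0 1. f x = (\<Sum>e\<in>reduced_exponents j t. b e * monomial_fun e x)"
    using assms unfolding reduced_on_sphere_def by blast
  then show ?thesis unfolding reduced_on_sphere_def
    by (intro exI[of _ "\<lambda>e. a * b e"]) (simp add: sum_distrib_left mult.assoc)
qed

lemma reduced_on_sphere_const: "reduced_on_sphere j t (\<lambda>x. a)"
proof -
  have "reduced_on_sphere j t (monomial_fun (\<lambda>_. 0))"
    by (rule reduced_on_sphere_monomial) (simp add: reduced_exponents_def)
  from reduced_on_sphere_cmult[OF this, of a] show ?thesis by (simp add: monomial_fun_def)
qed

lemma reduced_on_sphere_sum: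
  "(\<And>a. a \<in> A \<Longrightarrow> reduced_on_sphere j t (f a)) \<Longrightarrow> reduced_on_sphere j t (\<lambda>x. \<Sum>a\<in>A. f a x)"
  by (induction A rule: infinite_finite_induct)
    (auto intro: reduced_on_sphere_const reduced_on_sphere_add)

lemma reduced_on_sphere_cong:
  "(\<And>x. x \<in> sphere 0 1 \<Longrightarrow> f x = g x) \<Longrightarrow> reduced_on_sphere j t f = reduced_on_sphere j t g"
  by (simp add: reduced_on_sphere_def)

text \<open>
  A factor \<open>x $ j\<close> that would become a square is replaced using \<open>(x $ j)\<^sup>2 = 1 - (\<Sum>l\<noteq>j. (x $ l)\<^sup>2)\<close>.
\<close>

lemma reduced_on_sphere_coord_monomial:
  fixes j :: "'n::finite"
  assumes e: "e \<in> reduced_exponents j t"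
  shows "reduced_on_sphere j (Suc t) (\<lambda>x. x $ i * monomial_fun e x)"
proof (cases "i = j \<and> e j = 1")
  case False
  have "e(i := e i + 1) \<in> reduced_exponents j (Suc t)"
    using e False unfolding reduced_exponents_def mem_Collect_eq exponent_shift(2) by auto
  from reduced_on_sphere_monomial[OF this] show ?thesis
    unfolding exponent_shift(1)[abs_def] by simp
next
  case True
  define e' where "e' = e(j := 0)"
  have e_eq: "e = e'(j := e' j + 1)" using True by (auto simp: e'_def)
  have deg: "(\<Sum>l\<in>UNIV. e' l) + 1 \<le> t"
    using e exponent_shift(2)[of e' j 1, folded e_eq] by (simp add: reduced_exponents_def)
  have "x $ i * monomial_fun e x
      = monomial_fun e' x + (\<Sum>l\<in>UNIV - {j}. - 1 * monomial_fun (e'(l := e' l + 2)) x)"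
    if "x \<in> sphere 0 1" for x
  proof -
    have "(\<Sum>l\<in>UNIV. (x $ l)\<^sup>2) = 1"
      using that by (simp add: norm_eq_1 inner_vec_def power2_eq_square)
    then have "(x $ j)\<^sup>2 = 1 - (\<Sum>l\<in>UNIV - {j}. (x $ l)\<^sup>2)"
      by (simp add: sum.remove[of UNIV j])
    moreover have "x $ i * monomial_fun e x = (x $ j)\<^sup>2 * monomial_fun e' x"
      using True unfolding e_eq exponent_shift(1) by (simp add: power2_eq_square)
    ultimately show ?thesis
      unfolding exponent_shift(1) by (simp add: left_diff_distrib sum_distrib_right sum_negf)
  qed
  moreover have "reduced_on_sphere j (Suc t)
      (\<lambda>x. monomial_fun e' x + (\<Sum>l\<in>UNIV - {j}. - 1 * monomial_fun (e'(l := e' l + 2)) x))"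
  proof (intro reduced_on_sphere_add reduced_on_sphere_sum reduced_on_sphere_cmult
      reduced_on_sphere_monomial)
    show "e' \<in> reduced_exponents j (Suc t)"
      using deg by (simp add: reduced_exponents_def e'_def)
    show "e'(l := e' l + 2) \<in> reduced_exponents j (Suc t)" if "l \<in> UNIV - {j}" for l
      using deg that unfolding reduced_exponents_def mem_Collect_eq exponent_shift(2)
      by (auto simp: e'_def)
  qed
  ultimately show ?thesis using reduced_on_sphere_cong by (metis (no_types, lifting))
qed

lemma reduced_on_sphere_expand:
  assumes "reduced_on_sphere j t f"
    and "\<And>e. e \<in> reduced_exponents j t \<Longrightarrow> reduced_on_sphere j t' (\<lambda>x. h x * monomial_fun e x)"
  shows "reduced_on_sphere j t' (\<lambda>x. h x * f x)"
proof -
  obtain c where c: "\<forall>x\<in>sphere 0 1. f x = (\<Sum>e\<in>reduced_exponents j t. c e * monomial_fun e x)"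
    using assms(1) unfolding reduced_on_sphere_def by blast
  have "reduced_on_sphere j t' (\<lambda>x. \<Sum>e\<in>reduced_exponents j t. c e * (h x * monomial_fun e x))"
    by (intro reduced_on_sphere_sum reduced_on_sphere_cmult assms(2))
  moreover have "h x * f x = (\<Sum>e\<in>reduced_exponents j t. c e * (h x * monomial_fun e x))"
    if "x \<in> sphere 0 1" for x
    using c that by (simp add: sum_distrib_left mult.left_commute)
  ultimately show ?thesis
    using reduced_on_sphere_cong by (metis (no_types, lifting))
qed

lemma poly_fun_reduced_on_sphere: "poly_fun t f \<Longrightarrow> reduced_on_sphere j t f"
proof (induction rule: poly_fun.induct)
  case (const t c)
  show ?case by (rule reduced_on_sphere_const)
next
  case (add t f g)
  show ?case by (rule reduced_on_sphere_add[OF add.IH])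
next
  case (coord t f i)
  show ?case by (rule reduced_on_sphere_expand[OF coord.IH reduced_on_sphere_coord_monomial])
next
  case (up t f)
  have "reduced_on_sphere j (Suc t) (monomial_fun e)" if "e \<in> reduced_exponents j t" for e
    using that by (intro reduced_on_sphere_monomial) (simp add: reduced_exponents_def)
  then show ?case
    using reduced_on_sphere_expand[OF up.IH, of "Suc t" "\<lambda>_. 1"] by simp
qed

section \<open>Integration over the sphere\<close>

abbreviation sphere_integral :: "(real ^ 'n::finite \<Rightarrow> real) \<Rightarrow> real" where
  "sphere_integral f \<equiv> integral\<^sup>L sphere_measure f"

lemma sphere_integrable_continuous:
  fixes f :: "real ^ 'n::finite \<Rightarrow> real"
  assumes cont: "continuous_on (sphere 0 1) f"
  shows "integrable sphere_measure f"
proof -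
  interpret finite_measure "sphere_measure :: (real ^ 'n) measure"
    by (rule finite_measureI) (simp add: emeasure_sphere_measure_sphere)
  have "f \<in> borel_measurable (restrict_space borel (sphere 0 1))"
    by (rule borel_measurable_continuous_on_restrict[OF cont])
  then have meas: "f \<in> borel_measurable sphere_measure"
    by (simp cong: measurable_cong_sets add: sets_sphere_measure)
  have "bounded (f ` sphere 0 1)"
    by (intro compact_imp_bounded compact_continuous_image cont compact_sphere)
  then obtain b where "\<forall>x\<in>sphere 0 1. norm (f x) \<le> b"
    unfolding bounded_iff by blast
  then show ?thesis
    by (intro integrable_const_bound[where B = b] meas AE_I2) (simp del: mem_sphere_0)
qed

lemma sphere_integral_const: "sphere_integral (\<lambda>x :: real ^ 'n::finite. c) = c"
proof -
  have "measure (sphere_measure :: (real ^ 'n) measure) (sphere 0 1) = 1"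
    by (simp add: measure_def emeasure_sphere_measure_sphere)
  then show ?thesis by simp
qed

lemma sphere_integral_mono:
  fixes f g :: "real ^ 'n::finite \<Rightarrow> real"
  assumes "continuous_on (sphere 0 1) f" "continuous_on (sphere 0 1) g"
    and "\<And>x. x \<in> sphere 0 1 \<Longrightarrow> f x \<le> g x"
  shows "sphere_integral f \<le> sphere_integral g"
  using assms by (intro integral_mono sphere_integrable_continuous) auto

lemma sphere_integral_cong:
  fixes f g :: "real ^ 'n::finite \<Rightarrow> real"
  assumes "\<And>x. x \<in> sphere 0 1 \<Longrightarrow> f x = g x"
  shows "sphere_integral f = sphere_integral g"
  using assms by (intro Bochner_Integration.integral_cong) auto

lemma sphere_integral_sum:
  fixes f :: "'i \<Rightarrow> real ^ 'n::finite \<Rightarrow> real"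
  assumes "\<And>i. i \<in> I \<Longrightarrow> continuous_on (sphere 0 1) (f i)"
  shows "sphere_integral (\<lambda>x. \<Sum>i\<in>I. f i x) = (\<Sum>i\<in>I. sphere_integral (f i))"
  using assms by (intro Bochner_Integration.integral_sum sphere_integrable_continuous) auto

lemma sets_sphere_measure_iff:
  "A \<in> sets (sphere_measure :: (real ^ 'n::finite) measure) \<longleftrightarrow> A \<in> sets borel \<and> A \<subseteq> sphere 0 1"
  unfolding sets_sphere_measure by (subst sets_restrict_space_iff) auto

lemma sphere_integral_orthogonal:
  fixes f :: "real ^ 'n::finite \<Rightarrow> real"
    and T :: "real ^ 'n \<Rightarrow> real ^ 'n"
  assumes T: "orthogonal_transformation T" and cont: "continuous_on (sphere 0 1) f"
  shows "sphere_integral (\<lambda>x. f (T x)) = sphere_integral f"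
proof -
  let ?M = "sphere_measure :: (real ^ 'n) measure"
  have bij: "bij T" using orthogonal_transformation_bij[OF T] .
  have "T \<in> borel_measurable borel"
    using T by (intro borel_measurable_continuous_onI linear_continuous_on)
      (simp add: orthogonal_transformation_linear linear_conv_bounded_linear[symmetric])
  then have "T \<in> measurable (restrict_space borel (sphere 0 1)) (restrict_space borel (sphere 0 1))"
    by (intro measurable_restrict_space2 measurable_restrict_space1)
      (auto simp: space_restrict_space orthogonal_transformation_norm[OF T])
  then have meas: "T \<in> measurable ?M ?M"
    by (simp cong: measurable_cong_sets add: sets_sphere_measure)
  have inv_eq: "distr ?M ?M T = ?M"
  proof (rule measure_eqI)
    fix A assume A: "A \<in> sets (distr ?M ?M T)"
    then have A': "A \<in> sets borel" "A \<subseteq> sphere 0 1"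
      by (simp_all add: sets_sphere_measure_iff)
    have "T -` A \<inter> sphere 0 1 = inv_into UNIV T ` A"
      using A'(2) orthogonal_transformation_norm[OF T]
      by (auto simp: bij_vimage_eq_inv_image[OF bij, symmetric])
    then show "emeasure (distr ?M ?M T) A = emeasure ?M A"
      using A A' emeasure_sphere_measure_orthogonal_image[OF orthogonal_transformation_inv[OF T], of A]
      by (simp add: emeasure_distr[OF meas])
  qed simp
  have "integral\<^sup>L (distr ?M ?M T) f = integral\<^sup>L ?M (\<lambda>x. f (T x))"
    using meas sphere_integrable_continuous[OF cont] by (intro integral_distr) auto
  then show ?thesis by (simp add: inv_eq)
qed

text \<open>
  A nonempty relatively open subset of the sphere has positive measure, since the cone over it
  contains a ball.
\<close>

lemma continuous_zero_of_sphere_integral_zero: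
  fixes f :: "real ^ 'n::finite \<Rightarrow> real"
  assumes cont: "continuous_on (sphere 0 1) f" and nn: "\<And>x. x \<in> sphere 0 1 \<Longrightarrow> f x \<ge> 0"
    and int: "sphere_integral f = 0" and x: "x \<in> sphere 0 1"
  shows "f x = 0"
proof (rule ccontr)
  assume "f x \<noteq> 0"
  let ?M = "sphere_measure :: (real ^ 'n) measure"
  let ?A = "sphere 0 1 \<inter> f -` {0<..}"
  have fx: "f x > 0" using nn[OF x] \<open>f x \<noteq> 0\<close> by simp
  have "AE y in ?M. 0 \<le> f y" using nn by (intro AE_I2) simp
  then have AE: "AE y in ?M. f y = 0"
    using integral_nonneg_eq_0_iff_AE[OF sphere_integrable_continuous[OF cont]] int by simp
  have "openin (top_of_set (sphere 0 1)) ?A"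
    by (intro continuous_openin_preimage_gen cont) auto
  then obtain U where U: "open U" "?A = sphere 0 1 \<inter> U" by (auto simp: openin_open)
  have A: "?A \<in> sets ?M" unfolding sets_sphere_measure_iff U(2) using U(1) by auto
  have "{y \<in> space ?M. \<not> f y = 0} = ?A"
    using nn by (force simp: less_le)
  then have "emeasure ?M ?A = 0"
    using AE_iff_measurable[OF A, of "\<lambda>y. f y = 0"] AE by simp
  then have zero: "emeasure lborel {y \<in> ball 0 1. y /\<^sub>R norm y \<in> ?A} = 0"
    using A emeasure_lborel_ball_finite[of "0 :: real ^ 'n" 1]
    by (auto simp: emeasure_sphere_measure sets_sphere_measure_iff)
  have "open ((ball 0 1 - {0}) \<inter> (\<lambda>y :: real ^ 'n. y /\<^sub>R norm y) -` U)"
    using U(1) by (intro continuous_open_preimage continuous_intros) auto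
  moreover have "x /\<^sub>R 2 \<in> (ball 0 1 - {0}) \<inter> (\<lambda>y. y /\<^sub>R norm y) -` U"
  proof -
    have "x \<in> U" using x fx U(2) by blast
    moreover have "norm x = 1" "x \<noteq> 0" using x by auto
    ultimately show ?thesis by simp
  qed
  ultimately obtain r where r: "r > 0"
      "ball (x /\<^sub>R 2) r \<subseteq> (ball 0 1 - {0}) \<inter> (\<lambda>y. y /\<^sub>R norm y) -` U"
    by (meson open_contains_ball)
  have sub: "ball (x /\<^sub>R 2) r \<subseteq> {y \<in> ball 0 1. y /\<^sub>R norm y \<in> ?A}"
  proof
    fix y assume y: "y \<in> ball (x /\<^sub>R 2) r"
    then have "y \<in> ball 0 1 - {0}" "y /\<^sub>R norm y \<in> U" using r(2) by blast+
    then show "y \<in> {y \<in> ball 0 1. y /\<^sub>R norm y \<in> ?A}"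
      unfolding U(2) by simp
  qed
  have "{y \<in> ball 0 1. y /\<^sub>R norm y \<in> ?A} = ball 0 1 \<inter> ((\<lambda>y. y /\<^sub>R norm y) -` ?A \<inter> space borel)"
    by auto
  also have "\<dots> \<in> sets borel"
  proof (rule sets.Int)
    have "(\<lambda>y :: real ^ 'n. y /\<^sub>R norm y) \<in> measurable borel borel" by measurable
    moreover have "?A \<in> sets borel" using A by (simp only: sets_sphere_measure_iff)
    ultimately show "(\<lambda>y. y /\<^sub>R norm y) -` ?A \<inter> space borel \<in> sets borel"
      by (rule measurable_sets)
  qed simp
  finally have "{y \<in> ball 0 1. y /\<^sub>R norm y \<in> ?A} \<in> sets lborel"
    by (simp only: sets_lborel)
  from emeasure_mono[OF sub this] have "emeasure lborel (ball (x /\<^sub>R 2) r) \<le> 0"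
    by (simp only: zero)
  then have "measure lborel (ball (x /\<^sub>R 2) r) = 0"
    by (simp add: measure_def)
  then show False
    using content_ball_pos[OF r(1), of "x /\<^sub>R 2"] by linarith
qed

section \<open>Orthonormal bases of mean-zero polynomials\<close>

definition orthonormal :: "nat \<Rightarrow> (nat \<Rightarrow> real ^ 'n::finite \<Rightarrow> real) \<Rightarrow> bool" where
  "orthonormal m e \<longleftrightarrow> (\<forall>k<m. continuous_on (sphere 0 1) (e k)) \<and>
     (\<forall>j<m. \<forall>k<m. sphere_integral (\<lambda>x. e j x * e k x) = (if j = k then 1 else 0))"

lemma orthonormal_coefficient:
  fixes e :: "nat \<Rightarrow> real ^ 'n::finite \<Rightarrow> real"
  assumes e: "orthonormal m e" and j: "j < m"
  shows "sphere_integral (\<lambda>x. (\<Sum>k<m. a k * e k x) * e j x) = a j"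
proof -
  have cont: "continuous_on (sphere 0 1) (e k)" if "k < m" for k
    using e that by (simp add: orthonormal_def)
  have "sphere_integral (\<lambda>x. (\<Sum>k<m. a k * e k x) * e j x)
      = sphere_integral (\<lambda>x. \<Sum>k<m. a k * (e k x * e j x))"
    by (simp add: sum_distrib_right mult.assoc)
  also have "\<dots> = (\<Sum>k<m. a k * sphere_integral (\<lambda>x. e k x * e j x))"
    using cont j by (subst sphere_integral_sum) (auto intro!: continuous_intros)
  also have "\<dots> = (\<Sum>k<m. if k = j then a k else 0)"
    using e j by (intro sum.cong) (auto simp: orthonormal_def)
  also have "\<dots> = a j" using j by simp
  finally show ?thesis .
qed

lemma orthonormal_parseval:
  fixes e :: "nat \<Rightarrow> real ^ 'n::finite \<Rightarrow> real"
  assumes e: "orthonormal m e"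
  shows "sphere_integral (\<lambda>x. (\<Sum>k<m. a k * e k x) * (\<Sum>k<m. b k * e k x)) = (\<Sum>k<m. a k * b k)"
proof -
  have cont: "continuous_on (sphere 0 1) (e k)" if "k < m" for k
    using e that by (simp add: orthonormal_def)
  have "sphere_integral (\<lambda>x. (\<Sum>k<m. a k * e k x) * (\<Sum>k<m. b k * e k x))
      = sphere_integral (\<lambda>x. \<Sum>j<m. b j * ((\<Sum>k<m. a k * e k x) * e j x))"
    by (simp add: sum_distrib_left mult.left_commute)
  also have "\<dots> = (\<Sum>j<m. b j * sphere_integral (\<lambda>x. (\<Sum>k<m. a k * e k x) * e j x))"
    using cont by (subst sphere_integral_sum) (auto intro!: continuous_intros)
  also have "\<dots> = (\<Sum>j<m. b j * a j)"
    using orthonormal_coefficient[OF e] by (intro sum.cong) auto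
  finally show ?thesis by (simp add: mult.commute)
qed

text \<open>
  A vector that depends on its predecessors contributes nothing, so \<open>m\<close> may be smaller than the
  length of \<open>gs\<close>. A remainder of norm zero vanishes at every point of the sphere by continuity, which gives
  pointwise expansions rather than expansions almost everywhere.
\<close>

lemma gram_schmidt_on_sphere:
  fixes V :: "(real ^ 'n::finite \<Rightarrow> real) \<Rightarrow> bool"
  assumes lin: "\<And>f g c. V f \<Longrightarrow> V g \<Longrightarrow> V (\<lambda>x. f x + c * g x)"
    and cont: "\<And>f. V f \<Longrightarrow> continuous_on (sphere 0 1) f"
  shows "(\<forall>g\<in>set gs. V g) \<Longrightarrow> \<exists>m e. m \<le> length gs \<and> (\<forall>k<m. V (e k)) \<and> orthonormal m e \<and>
    (\<forall>g\<in>set gs. \<exists>c. \<forall>x\<in>sphere 0 1. g x = (\<Sum>k<m. c k * e k x))"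
proof (induction gs)
  case Nil
  then show ?case by (intro exI[of _ 0]) (simp add: orthonormal_def)
next
  case (Cons g gs)
  then have "\<forall>h\<in>set gs. V h" by simp
  from Cons.IH[OF this] obtain m e where me: "m \<le> length gs \<and> (\<forall>k<m. V (e k)) \<and>
      orthonormal m e \<and> (\<forall>h\<in>set gs. \<exists>c. \<forall>x\<in>sphere 0 1. h x = (\<Sum>k<m. c k * e k x))"
    by (elim exE)
  then have m: "m \<le> length gs" and eV: "\<And>k. k < m \<Longrightarrow> V (e k)" and e: "orthonormal m e"
    and span: "\<And>h. h \<in> set gs \<Longrightarrow> \<exists>c. \<forall>x\<in>sphere 0 1. h x = (\<Sum>k<m. c k * e k x)"
    by simp_all
  have gV: "V g" using Cons.prems by simp
  have ce: "continuous_on (sphere 0 1) (e k)" if "k < m" for k using cont eV that by blast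
  define a where "a k = sphere_integral (\<lambda>x. g x * e k x)" for k
  define r where "r x = g x + - 1 * (\<Sum>k<m. a k * e k x)" for x
  have sumV: "n \<le> m \<Longrightarrow> V (\<lambda>x. g x + - 1 * (\<Sum>k<n. a k * e k x))" for n
  proof (induction n)
    case (Suc n)
    have "V (\<lambda>x. (g x + - 1 * (\<Sum>k<n. a k * e k x)) + (- a n) * e n x)"
      using Suc by (intro lin[OF _ eV]) simp_all
    then show ?case by (simp add: algebra_simps)
  qed (use gV in simp)
  have rV: "V r" unfolding r_def[abs_def] by (rule sumV) simp
  have cr: "continuous_on (sphere 0 1) r" using cont[OF rV] .
  have g_eq: "g x = r x + (\<Sum>k<m. a k * e k x)" for x by (simp add: r_def)
  define \<nu> where "\<nu> = sphere_integral (\<lambda>x. r x * r x)"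
  show ?case
  proof (cases "\<nu> = 0")
    case True
    have "r x = 0" if "x \<in> sphere 0 1" for x
      using continuous_zero_of_sphere_integral_zero[of "\<lambda>x. r x * r x" x] True cr that
      by (auto simp: \<nu>_def intro!: continuous_intros)
    then have "\<exists>c. \<forall>x\<in>sphere 0 1. g x = (\<Sum>k<m. c k * e k x)"
      using g_eq by (intro exI[of _ a]) simp
    then show ?thesis
      using m eV e span by (intro exI[of _ m] exI[of _ e]) auto
  next
    case False
    have "\<nu> \<ge> 0" unfolding \<nu>_def by (rule Bochner_Integration.integral_nonneg) simp
    then have \<nu>: "\<nu> > 0" using False by simp
    define e' where "e' = e(m := (\<lambda>x. r x + (1 / sqrt \<nu> - 1) * r x))"
    have e'm: "e' m x = r x / sqrt \<nu>" for x by (simp add: e'_def algebra_simps)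
    have e'k: "e' k = e k" if "k < m" for k using that by (simp add: e'_def)
    have e'V: "V (e' k)" if "k < Suc m" for k
      using that eV[of k] lin[OF rV rV] by (cases "k = m") (auto simp: e'_def)
    have r_orth: "sphere_integral (\<lambda>x. r x * e j x) = 0" if j: "j < m" for j
    proof -
      have "sphere_integral (\<lambda>x. g x * e j x)
          = sphere_integral (\<lambda>x. r x * e j x + (\<Sum>k<m. a k * e k x) * e j x)"
        by (simp add: g_eq distrib_right)
      also have "\<dots> = sphere_integral (\<lambda>x. r x * e j x)
          + sphere_integral (\<lambda>x. (\<Sum>k<m. a k * e k x) * e j x)"
        using cr ce j by (intro Bochner_Integration.integral_add sphere_integrable_continuous)
          (auto intro!: continuous_intros)
      finally show ?thesis
        using orthonormal_coefficient[OF e j, of a] by (simp add: a_def)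
    qed
    have "orthonormal (Suc m) e'"
      unfolding orthonormal_def
    proof (intro conjI allI impI)
      show "continuous_on (sphere 0 1) (e' k)" if "k < Suc m" for k
        using cont[OF e'V[OF that]] .
      show "sphere_integral (\<lambda>x. e' j x * e' k x) = (if j = k then 1 else 0)"
        if "j < Suc m" "k < Suc m" for j k
      proof -
        consider "j < m" "k < m" | "j = m" "k < m" | "j < m" "k = m" | "j = m" "k = m"
          using \<open>j < Suc m\<close> \<open>k < Suc m\<close> by linarith
        then show ?thesis
        proof cases
          case 1
          then show ?thesis using e by (simp add: e'k orthonormal_def)
        next
          case 2
          then show ?thesis using r_orth[of k] by (simp add: e'k e'm)
        next
          case 3
          then show ?thesis using r_orth[of j] by (simp add: e'k e'm mult.commute[of "e j _"])
        next
          case 4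
          have "e' m x * e' m x = r x * r x / \<nu>" for x
            using \<nu> by (simp add: e'm)
          then show ?thesis using 4 \<nu> by (simp add: \<nu>_def)
        qed
      qed
    qed
    moreover have "\<exists>c. \<forall>x\<in>sphere 0 1. h x = (\<Sum>k<Suc m. c k * e' k x)" if "h \<in> set (g # gs)" for h
    proof (cases "h = g")
      case True
      have "g x = (\<Sum>k<Suc m. (a(m := sqrt \<nu>)) k * e' k x)" for x
        using \<nu> by (simp add: g_eq e'k e'm)
      then show ?thesis using True by blast
    next
      case False
      then obtain c where c: "\<forall>x\<in>sphere 0 1. h x = (\<Sum>k<m. c k * e k x)"
        using span[of h] \<open>h \<in> set (g # gs)\<close> by auto
      then have "\<forall>x\<in>sphere 0 1. h x = (\<Sum>k<Suc m. (c(m := 0)) k * e' k x)"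
        by (simp add: e'k)
      then show ?thesis by blast
    qed
    ultimately show ?thesis
      using m e'V by (intro exI[of _ "Suc m"] exI[of _ e']) auto
  qed
qed

definition mean_zero_basis :: "nat \<Rightarrow> nat \<Rightarrow> (nat \<Rightarrow> real ^ 'n::finite \<Rightarrow> real) \<Rightarrow> bool" where
  "mean_zero_basis t m e \<longleftrightarrow> orthonormal m e \<and>
     (\<forall>k<m. poly_fun t (e k) \<and> sphere_integral (e k) = 0) \<and>
     (\<forall>f. poly_fun t f \<longrightarrow> sphere_integral f = 0 \<longrightarrow>
        (\<exists>c. \<forall>x\<in>sphere 0 1. f x = (\<Sum>k<m. c k * e k x)))"

text \<open>
  Subtracting its mean from each reduced monomial gives functions that span the space of functions of
  mean zero, and Gram-Schmidt applies to these.
\<close>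

lemma mean_zero_basis_exists:
  "\<exists>m (e :: nat \<Rightarrow> real ^ 'n::finite \<Rightarrow> real).
     m \<le> 2 * (t + 1) ^ (CARD('n) - 1) \<and> mean_zero_basis t m e"
proof -
  fix j :: 'n
  let ?R = "reduced_exponents j t"
  let ?V = "\<lambda>f :: real ^ 'n \<Rightarrow> real. poly_fun t f \<and> sphere_integral f = 0"
  define g where "g e x = monomial_fun e x + (- sphere_integral (monomial_fun e))"
    for e and x :: "real ^ 'n"
  have int: "integrable sphere_measure f" if "poly_fun t f" for f :: "real ^ 'n \<Rightarrow> real"
    using that by (intro sphere_integrable_continuous poly_fun_continuous)
  have mono: "poly_fun t (monomial_fun e :: real ^ 'n \<Rightarrow> real)" if "e \<in> ?R" for e
    using that unfolding monomial_fun_def[abs_def]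
    by (intro poly_fun_mono[OF poly_fun_monomial]) (simp add: reduced_exponents_def)
  have gV: "?V (g e)" if "e \<in> ?R" for e
  proof
    show "poly_fun t (g e)"
      unfolding g_def[abs_def] by (rule poly_fun.add[OF mono[OF that] poly_fun.const])
    show "sphere_integral (g e) = 0"
      unfolding g_def[abs_def]
        Bochner_Integration.integral_add[OF int[OF mono[OF that]] int[OF poly_fun.const]]
        sphere_integral_const by simp
  qed
  obtain L where L: "set L = ?R" "distinct L"
    using finite_distinct_list[OF reduced_exponents_finite_card(1)] by metis
  have "\<exists>m e. m \<le> length (map g L) \<and> (\<forall>k<m. ?V (e k)) \<and> orthonormal m e \<and>
      (\<forall>h\<in>set (map g L). \<exists>c. \<forall>x\<in>sphere 0 1. h x = (\<Sum>k<m. c k * e k x))"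
  proof (rule gram_schmidt_on_sphere)
    show "?V (\<lambda>x. f x + c * h x)" if "?V f" "?V h" for f h c
      using that int[of f] int[of h] by (auto intro: poly_fun.add poly_fun_cmult)
    show "continuous_on (sphere 0 1) f" if "?V f" for f
      using that poly_fun_continuous by blast
    show "\<forall>h\<in>set (map g L). ?V h" using gV L(1) by simp
  qed
  then obtain m e where me: "m \<le> length (map g L) \<and> (\<forall>k<m. ?V (e k)) \<and> orthonormal m e \<and>
      (\<forall>h\<in>set (map g L). \<exists>c. \<forall>x\<in>sphere 0 1. h x = (\<Sum>k<m. c k * e k x))"
    by (elim exE)
  then have m: "m \<le> length L" and eV: "\<And>k. k < m \<Longrightarrow> ?V (e k)" and e: "orthonormal m e"
    and span: "\<And>u. u \<in> ?R \<Longrightarrow> \<exists>c. \<forall>x\<in>sphere 0 1. g u x = (\<Sum>k<m. c k * e k x)"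
    using L(1) by simp_all
  have "m \<le> 2 * (t + 1) ^ (CARD('n) - 1)"
    using m L reduced_exponents_finite_card(2)[of j t] by (simp add: distinct_card[symmetric])
  moreover have "mean_zero_basis t m e"
    unfolding mean_zero_basis_def
  proof (intro conjI allI impI)
    fix f :: "real ^ 'n \<Rightarrow> real" assume f: "poly_fun t f" and f0: "sphere_integral f = 0"
    obtain b where b: "\<And>x. x \<in> sphere 0 1 \<Longrightarrow> f x = (\<Sum>u\<in>?R. b u * monomial_fun u x)"
      using poly_fun_reduced_on_sphere[OF f, of j] unfolding reduced_on_sphere_def by blast
    obtain c where c: "\<And>u x. u \<in> ?R \<Longrightarrow> x \<in> sphere 0 1 \<Longrightarrow> g u x = (\<Sum>k<m. c u k * e k x)"
      using span by metis
    have "0 = (\<Sum>u\<in>?R. b u * sphere_integral (monomial_fun u))"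
    proof -
      have "0 = sphere_integral (\<lambda>x :: real ^ 'n. \<Sum>u\<in>?R. b u * monomial_fun u x)"
        unfolding f0[symmetric] by (rule sphere_integral_cong[OF b])
      also have "\<dots> = (\<Sum>u\<in>?R. sphere_integral (\<lambda>x :: real ^ 'n. b u * monomial_fun u x))"
        using poly_fun_continuous[OF mono]
        by (intro sphere_integral_sum continuous_on_mult continuous_on_const)
      finally show ?thesis by simp
    qed
    then have "f x = (\<Sum>u\<in>?R. b u * g u x)" if "x \<in> sphere 0 1" for x
      using b[OF that] by (simp add: g_def right_diff_distrib sum_subtractf)
    then have "f x = (\<Sum>u\<in>?R. \<Sum>k<m. b u * c u k * e k x)" if "x \<in> sphere 0 1" for x
      using that c by (simp add: sum_distrib_left mult.assoc)
    then have "f x = (\<Sum>k<m. (\<Sum>u\<in>?R. b u * c u k) * e k x)" if "x \<in> sphere 0 1" for x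
      using that by (simp add: sum_distrib_right sum.swap[of _ "{..<m}"])
    then show "\<exists>c. \<forall>x\<in>sphere 0 1. f x = (\<Sum>k<m. c k * e k x)"
      by (intro exI[of _ "\<lambda>k. \<Sum>u\<in>?R. b u * c u k"] ballI)
  qed (use e eV in auto)
  ultimately show ?thesis by blast
qed

text \<open>
  The sum is the squared norm of evaluation at \<open>x\<close> as a functional on the space spanned by the basis.
  This norm does not depend on \<open>x\<close> because the space and its inner product are invariant under
  rotations, and the integral of the sum is \<open>m\<close> by orthonormality.
\<close>

lemma sum_sq_basis:
  fixes e :: "nat \<Rightarrow> real ^ 'n::finite \<Rightarrow> real"
  assumes e: "mean_zero_basis t m e" and x: "x \<in> sphere 0 1"
  shows "(\<Sum>k<m. (e k x)\<^sup>2) = real m"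
proof -
  define L where "L z = (\<Sum>k<m. (e k z)\<^sup>2)" for z
  have on: "orthonormal m e" and poly: "\<And>k. k < m \<Longrightarrow> poly_fun t (e k)"
    and mean0: "\<And>k. k < m \<Longrightarrow> sphere_integral (e k) = 0"
    using e by (auto simp: mean_zero_basis_def)
  have cont: "continuous_on (sphere 0 1) (e k)" if "k < m" for k
    using poly[OF that] by (rule poly_fun_continuous)
  have le: "L y \<le> L z" if y: "y \<in> sphere 0 1" and z: "z \<in> sphere 0 1" for y z
  proof -
    obtain T where T: "orthogonal_transformation T" "T z = y"
      using orthogonal_transformation_exists[of z y] y z by auto
    \<comment> \<open>The reproducing kernel at \<open>y\<close>, an extremal function for evaluation there.\<close>
    define h where "h w = (\<Sum>k<m. e k y * e k w)" for w
    have ph: "poly_fun t h"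
      unfolding h_def[abs_def] by (intro poly_fun_sum poly_fun_cmult poly) simp
    then have ch: "continuous_on (sphere 0 1) h" by (rule poly_fun_continuous)
    have "sphere_integral h = (\<Sum>k<m. e k y * sphere_integral (e k))"
      unfolding h_def using cont by (subst sphere_integral_sum) (auto intro!: continuous_intros)
    then have h0: "sphere_integral (\<lambda>w. h (T w)) = 0"
      using sphere_integral_orthogonal[OF T(1) ch] mean0 by simp
    have "poly_fun t (\<lambda>w. h (T w))"
      by (rule poly_fun_linear_comp[OF orthogonal_transformation_linear[OF T(1)] ph])
    then obtain a where a: "\<And>w. w \<in> sphere 0 1 \<Longrightarrow> h (T w) = (\<Sum>k<m. a k * e k w)"
      using e h0 unfolding mean_zero_basis_def by blast
    have "(\<Sum>k<m. (a k)\<^sup>2) = sphere_integral (\<lambda>w. (\<Sum>k<m. a k * e k w) * (\<Sum>k<m. a k * e k w))"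
      using orthonormal_parseval[OF on, of a a] by (simp add: power2_eq_square)
    also have "\<dots> = sphere_integral (\<lambda>w. h (T w) * h (T w))"
      using a by (intro sphere_integral_cong) simp
    also have "\<dots> = sphere_integral (\<lambda>w. h w * h w)"
      by (rule sphere_integral_orthogonal[OF T(1), of "\<lambda>w. h w * h w"])
        (intro continuous_intros ch)
    also have "\<dots> = L y"
      using orthonormal_parseval[OF on, of "\<lambda>k. e k y" "\<lambda>k. e k y"]
      by (simp add: h_def L_def power2_eq_square)
    finally have norm_a: "(\<Sum>k<m. (a k)\<^sup>2) = L y" .
    have "L y = (\<Sum>k<m. a k * e k z)"
      using a[OF z] T(2) by (simp add: h_def L_def power2_eq_square)
    then have "(L y)\<^sup>2 \<le> L y * L z"
      using Cauchy_Schwarz_ineq_sum[of a "\<lambda>k. e k z" "{..<m}"] norm_a by (simp add: L_def)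
    moreover have "L y \<ge> 0" "L z \<ge> 0" by (simp_all add: L_def sum_nonneg)
    ultimately show ?thesis
      by (cases "L y = 0") (auto simp: power2_eq_square)
  qed
  have "L x = sphere_integral (\<lambda>z :: real ^ 'n. L x)" by (rule sphere_integral_const[symmetric])
  also have "\<dots> = sphere_integral L"
    using le x by (intro sphere_integral_cong antisym) auto
  also have "\<dots> = (\<Sum>k<m. sphere_integral (\<lambda>z. e k z * e k z))"
    unfolding L_def power2_eq_square using cont
    by (subst sphere_integral_sum) (auto intro!: continuous_intros)
  also have "\<dots> = real m"
    using on by (simp add: orthonormal_def)
  finally show ?thesis by (simp add: L_def)
qed

text \<open>
  The reproducing kernel \<open>K\<close> at \<open>x\<close> has mean zero and is at most \<open>m\<close> by Cauchy-Schwarz. Hence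
  \<open>f x = \<integral>(f + c) * K \<le> m * \<integral>(f + c) = m * c\<close> for \<open>f \<ge> - c\<close> of mean zero: a function of mean zero
  that is not very negative anywhere is not very large anywhere.
\<close>

lemma basis_upper_bound:
  fixes e :: "nat \<Rightarrow> real ^ 'n::finite \<Rightarrow> real"
  assumes e: "mean_zero_basis t m e"
    and lower: "\<And>z. z \<in> sphere 0 1 \<Longrightarrow> - c \<le> (\<Sum>k<m. a k * e k z)"
    and x: "x \<in> sphere 0 1"
  shows "(\<Sum>k<m. a k * e k x) \<le> real m * c"
proof -
  have on: "orthonormal m e" and poly: "\<And>k. k < m \<Longrightarrow> poly_fun t (e k)"
    and mean0: "\<And>k. k < m \<Longrightarrow> sphere_integral (e k) = 0"
    using e by (auto simp: mean_zero_basis_def)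
  define f where "f z = (\<Sum>k<m. a k * e k z)" for z
  define K where "K z = (\<Sum>k<m. e k x * e k z)" for z
  have cont: "continuous_on (sphere 0 1) (e k)" if "k < m" for k
    using poly[OF that] by (rule poly_fun_continuous)
  have cf: "continuous_on (sphere 0 1) f" and cK: "continuous_on (sphere 0 1) K"
    unfolding f_def[abs_def] K_def[abs_def] by (intro continuous_intros cont; simp)+
  have K0: "sphere_integral K = 0" and f0: "sphere_integral f = 0"
    unfolding f_def K_def using cont mean0
    by (subst sphere_integral_sum; auto intro!: continuous_intros)+
  have K_le: "K z \<le> real m" if z: "z \<in> sphere 0 1" for z
  proof -
    have "(K z)\<^sup>2 \<le> (real m)\<^sup>2"
      using Cauchy_Schwarz_ineq_sum[of "\<lambda>k. e k x" "\<lambda>k. e k z" "{..<m}"]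
        sum_sq_basis[OF e x] sum_sq_basis[OF e z] by (simp add: K_def power2_eq_square)
    then show ?thesis by (rule power2_le_imp_le) simp
  qed
  have "f x = sphere_integral (\<lambda>z. f z * K z)"
    unfolding f_def K_def orthonormal_parseval[OF on] by (simp add: mult.commute)
  also have "\<dots> = sphere_integral (\<lambda>z. f z * K z) + c * sphere_integral K"
    by (simp add: K0)
  also have "\<dots> = sphere_integral (\<lambda>z. f z * K z + c * K z)"
    using cf cK by (subst Bochner_Integration.integral_add)
      (auto intro!: sphere_integrable_continuous continuous_intros)
  also have "\<dots> \<le> sphere_integral (\<lambda>z. real m * f z + real m * c)"
  proof (rule sphere_integral_mono)
    show "f z * K z + c * K z \<le> real m * f z + real m * c" if "z \<in> sphere 0 1" for z
      using mult_left_mono[OF K_le[OF that], of "f z + c"] lower[OF that]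
      by (simp add: f_def algebra_simps)
  qed (use cf cK in \<open>auto intro!: continuous_intros\<close>)
  also have "\<dots> = sphere_integral (\<lambda>z. real m * f z) + sphere_integral (\<lambda>z :: real ^ 'n. real m * c)"
    using cf by (intro Bochner_Integration.integral_add sphere_integrable_continuous)
      (auto intro!: continuous_intros)
  also have "\<dots> = real m * c"
    unfolding sphere_integral_const by (simp add: f0)
  finally show ?thesis by (simp add: f_def)
qed

text \<open>
  A function of unit norm is at least \<open>1\<close> in absolute value somewhere. If it is large and positive
  there, the upper bound still forces it to be as small as \<open>- 1 / m\<close> elsewhere.
\<close>

lemma basis_lower_bound:
  fixes e :: "nat \<Rightarrow> real ^ 'n::finite \<Rightarrow> real"
  assumes e: "mean_zero_basis t m e" and a: "(\<Sum>k<m. (a k)\<^sup>2) = 1"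
    and lower: "\<And>z. z \<in> sphere 0 1 \<Longrightarrow> - c \<le> (\<Sum>k<m. a k * e k z)"
  shows "1 \<le> real m * c"
proof -
  have on: "orthonormal m e" and poly: "\<And>k. k < m \<Longrightarrow> poly_fun t (e k)"
    using e by (auto simp: mean_zero_basis_def)
  define f where "f z = (\<Sum>k<m. a k * e k z)" for z
  have cont: "continuous_on (sphere 0 1) (\<lambda>z. f z * f z)"
    unfolding f_def using poly by (intro continuous_intros) (auto intro: poly_fun_continuous)
  have "sphere 0 1 \<noteq> ({} :: (real ^ 'n) set)" by simp
  then obtain x where x: "x \<in> sphere 0 1" "\<And>z. z \<in> sphere 0 1 \<Longrightarrow> f z * f z \<le> f x * f x"
    using continuous_attains_sup[OF compact_sphere _ cont] by blast
  have "1 = sphere_integral (\<lambda>z. f z * f z)"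
    using orthonormal_parseval[OF on, of a a] a by (simp add: f_def power2_eq_square)
  also have "\<dots> \<le> sphere_integral (\<lambda>z :: real ^ 'n. f x * f x)"
    using x(2) by (intro sphere_integral_mono cont) auto
  also have "\<dots> = (f x)\<^sup>2" by (simp only: sphere_integral_const power2_eq_square)
  finally have fx: "1 \<le> \<bar>f x\<bar>"
    using abs_le_square_iff[of 1 "f x"] by simp
  have "m > 0" using a by (cases m) auto
  moreover have "- c \<le> f x" "f x \<le> real m * c"
    using lower[OF x(1)] basis_upper_bound[OF e lower x(1)] by (simp_all add: f_def)
  moreover have "c \<le> real m * c" if "c \<ge> 0"
    using \<open>m > 0\<close> that mult_right_mono[of 1 "real m" c] by simp
  ultimately show ?thesis using fx by linarith
qed

section \<open>Completing a point set to a design\<close>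

text \<open>
  For a coefficient vector \<open>a\<close> let \<open>f a\<close> be the corresponding function. The points \<open>\<gamma> (pos a i)\<close> depend
  continuously on \<open>a\<close>, and all but \<open>m + 1\<close> of them are points where \<open>f a\<close> is almost minimal. With
  \<open>- c\<close> the minimum of \<open>f a\<close>, these contribute at most \<open>- c / 2\<close> each to the sum of \<open>f a\<close> over
  all points, whereas the exceptional ones and the points of \<open>Y\<close> contribute at most \<open>m * c\<close> each.
  The bound on \<open>N\<close> makes the sum negative whenever \<open>a\<close> has norm one. That sum is the inner product of
  \<open>a\<close> with the vector \<open>F a\<close> of the sums of the \<open>e k\<close>, so \<open>F\<close> points inward and has a zero.
\<close>

lemma prescribed_nodes_exist:
  fixes e :: "nat \<Rightarrow> real ^ 'n::finite \<Rightarrow> real" and Y :: "(real ^ 'n) multiset"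
  assumes n2: "CARD('n) \<ge> 2" and e: "mean_zero_basis t m e" and Y: "set_mset Y \<subseteq> sphere 0 1"
    and N: "N > (m + 1) + 2 * m * (m + 1 + size Y)"
  shows "\<exists>X. size X = N \<and> set_mset X \<subseteq> sphere 0 1 \<and>
    (\<forall>k<m. (\<Sum>x\<in>#X. e k x) + (\<Sum>y\<in>#Y. e k y) = 0)"
proof (cases "m = 0")
  case True
  obtain x0 :: "real ^ 'n" where "x0 \<in> sphere 0 1"
    using vector_choose_size[of 1] by auto
  then show ?thesis using True by (intro exI[of _ "replicate_mset N x0"]) auto
next
  case False
  then have m: "m > 0" by simp
  define f where "f a x = (\<Sum>k<m. a k * e k x)" for a :: "nat \<Rightarrow> real" and x
  have ce: "continuous_on S (e k)" if "k < m" for k S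
    using e that poly_fun_continuous unfolding mean_zero_basis_def by blast
  have cf: "continuous_on S (f a)" for a S
    unfolding f_def[abs_def] by (intro continuous_on_sum continuous_on_mult continuous_on_const ce) simp
  have e_le: "\<bar>e k x\<bar> \<le> real m" if "k < m" "x \<in> sphere 0 1" for k x
  proof -
    have "(e k x)\<^sup>2 \<le> (\<Sum>k<m. (e k x)\<^sup>2)"
      using that(1) by (intro member_le_sum) auto
    also have "\<dots> \<le> (real m)\<^sup>2"
      using sum_sq_basis[OF e that(2)] m by (simp add: power2_eq_square)
    finally show ?thesis using abs_le_square_iff[of "e k x" "real m"] by simp
  qed
  \<comment> \<open>The grid has mesh \<open>1 / R\<close>, so that \<open>f\<close> changes by at most \<open>m * (1 / R) * m = 1 / (4 * m)\<close>
    between a point and the vertices of its simplex. By \<open>basis_lower_bound\<close> this is at most a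
    quarter of the absolute value of the minimum.\<close>
  define R where "R = 4 * m ^ 3"
  have R: "R > 0" using m by (simp add: R_def)
  define D where "D = {a :: nat \<Rightarrow> real. (\<Sum>k<m. (a k)\<^sup>2) \<le> 1 \<and> (\<forall>k\<ge>m. a k = 0)}"
  define G where "G = {v :: nat \<Rightarrow> int. \<forall>k. (k \<in> {..<m} \<longrightarrow> v k \<in> {- int R..int R}) \<and>
    (k \<notin> {..<m} \<longrightarrow> v k = 0)}"
  have "finite G" unfolding G_def by (rule finite_set_of_finite_funs) auto
  then obtain vs where vs: "set vs = G" "distinct vs" using finite_distinct_list by blast
  define n where "n = length vs"
  define vert where "vert l k = real_of_int ((vs ! l) k) / real R" for l k
  have "\<exists>x\<in>sphere 0 1. \<forall>z\<in>sphere 0 1. f (vert l) x \<le> f (vert l) z" for l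
    by (rule continuous_attains_inf) (auto intro: cf)
  then obtain p where p: "\<And>l. p l \<in> sphere 0 1"
    and p_min: "\<And>l z. z \<in> sphere 0 1 \<Longrightarrow> f (vert l) (p l) \<le> f (vert l) z"
    by metis
  have "path_connected (sphere 0 1 :: (real ^ 'n) set)"
    using n2 by (intro path_connected_sphere) simp
  then obtain \<gamma> where \<gamma>: "continuous_on {0..real n} \<gamma>" "\<gamma> ` {0..real n} \<subseteq> sphere 0 1"
    and \<gamma>_p: "\<And>j. j \<le> n \<Longrightarrow> \<gamma> (real j) = p j"
    using path_through_points[of "sphere 0 1" p n] p by blast
  define \<phi> where "\<phi> a l = kuhn_weight m (\<lambda>k. real R * a k - real_of_int ((vs ! l) k))" for a l
  define wt where "wt a l = \<phi> a l / (\<Sum>l<n. \<phi> a l)" for a l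
  have \<phi>0: "\<phi> a l \<ge> 0" for a l by (simp add: \<phi>_def kuhn_weight_nonneg)
  have total_pos: "(\<Sum>l<n. \<phi> a l) > 0" if a: "a \<in> D" for a
  proof -
    define v where "v k = \<lfloor>real R * a k\<rfloor>" for k
    have "v k \<in> {- int R..int R}" if "k < m" for k
    proof -
      have "(a k)\<^sup>2 \<le> (\<Sum>k<m. (a k)\<^sup>2)" using that by (intro member_le_sum) auto
      then have "\<bar>a k\<bar> \<le> 1" using a abs_le_square_iff[of "a k" 1] by (simp add: D_def)
      then have "\<bar>real R * a k\<bar> \<le> real R" by (simp add: abs_mult mult_left_le)
      then show ?thesis unfolding v_def by (simp add: le_floor_iff floor_le_iff abs_le_iff)
    qed
    then have "v \<in> set vs" using a by (auto simp: vs(1) G_def v_def D_def)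
    then obtain l where l: "l < n" "vs ! l = v" by (auto simp: n_def in_set_conv_nth)
    then have "\<phi> a l > 0"
      using kuhn_weight_floor_pos[of m "\<lambda>k. real R * a k"] by (simp add: \<phi>_def v_def)
    then show ?thesis using l(1) \<phi>0 by (intro sum_pos2[of _ l]) auto
  qed
  have wt0: "wt a l \<ge> 0" for a l by (simp add: wt_def \<phi>0 sum_nonneg)
  have wt1: "(\<Sum>l<n. wt a l) = 1" if "a \<in> D" for a
    using total_pos[OF that] by (simp add: wt_def sum_divide_distrib[symmetric])
  have support: "card {l. l < n \<and> wt a l > 0} \<le> m + 1" if a: "a \<in> D" for a
  proof -
    have inj: "inj_on ((!) vs) {l. l < n \<and> wt a l > 0}"
      using vs(2) by (auto simp: inj_on_def nth_eq_iff_index_eq n_def)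
    have "card ((!) vs ` {l. l < n \<and> wt a l > 0}) \<le> m + 1"
    proof (rule card_kuhn_support[where x = "\<lambda>k. real R * a k"])
      fix v assume "v \<in> (!) vs ` {l. l < n \<and> wt a l > 0}"
      then obtain l where l: "l < n" "wt a l > 0" "v = vs ! l" by auto
      then have "v \<in> G" using vs(1) by (auto simp: n_def)
      then show "v k = 0" if "k \<ge> m" for k using that by (auto simp: G_def)
      have "\<phi> a l > 0" using l(2) total_pos[OF a] by (simp add: wt_def zero_less_divide_iff)
      then show "kuhn_weight m (\<lambda>k. real R * a k - real_of_int (v k)) > 0"
        by (simp add: \<phi>_def l(3))
    qed simp
    then show ?thesis using card_image[OF inj] by simp
  qed
  define pos where "pos a i =
    (\<Sum>k\<in>{1..<n}. min 1 (max 0 (real i + 1 - real N * (\<Sum>l<k. wt a l))))" for a and i :: nat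
  have pos_range: "pos a i \<in> {0..real n}" for a i
  proof -
    have "pos a i \<le> real (card {1..<n}) * 1"
      unfolding pos_def by (rule sum_bounded_above) simp
    moreover have "pos a i \<ge> 0" unfolding pos_def by (intro sum_nonneg) simp
    ultimately show ?thesis by auto
  qed
  then have \<gamma>_sphere: "\<gamma> (pos a i) \<in> sphere 0 1" for a i using \<gamma>(2) by blast
  have coord: "continuous_on D (\<lambda>a. a k)" for k
    by (rule continuous_on_subset[OF continuous_on_product_coordinates]) simp
  have c\<phi>: "continuous_on D (\<lambda>a. \<phi> a l)" for l
    unfolding \<phi>_def kuhn_weight_def
    by (intro continuous_on_mult continuous_on_prod continuous_on_max continuous_on_diff
        continuous_on_const continuous_on_rabs coord)
  have cwt: "continuous_on D (\<lambda>a. wt a l)" for l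
    unfolding wt_def using total_pos
    by (intro continuous_on_divide continuous_on_sum c\<phi>) force
  have cpos: "continuous_on D (\<lambda>a. pos a i)" for i
    unfolding pos_def
    by (intro continuous_on_sum continuous_on_min continuous_on_max continuous_on_diff
        continuous_on_mult continuous_on_const cwt)
  define F where "F a k = (\<Sum>i<N. e k (\<gamma> (pos a i))) + (\<Sum>y\<in>#Y. e k y)" for a k
  have "\<exists>a\<in>D. \<forall>k<m. F a k = 0"
    unfolding D_def
  proof (rule zero_of_inward_map_on_ball[OF m], fold D_def)
    show "continuous_on D (\<lambda>a. F a k)" if "k < m" for k
      unfolding F_def
    proof (intro continuous_on_add continuous_on_sum continuous_on_const)
      fix i
      have "continuous_on D (\<lambda>a. \<gamma> (pos a i))"
        using pos_range by (intro continuous_on_compose2[OF \<gamma>(1) cpos]) blast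
      from continuous_on_compose2[OF ce[OF that] this subset_UNIV]
      show "continuous_on D (\<lambda>a. e k (\<gamma> (pos a i)))" .
    qed
  next
    fix a assume a: "a \<in> D" and a1: "(\<Sum>k<m. (a k)\<^sup>2) = 1"
    have "\<exists>x\<in>sphere 0 1. \<forall>z\<in>sphere 0 1. f a x \<le> f a z"
      by (rule continuous_attains_inf) (auto intro: cf)
    then obtain x0 where x0: "x0 \<in> sphere 0 1" "\<And>z. z \<in> sphere 0 1 \<Longrightarrow> f a x0 \<le> f a z"
      by blast
    define c where "c = - f a x0"
    have lower: "- c \<le> (\<Sum>k<m. a k * e k z)" if "z \<in> sphere 0 1" for z
      using x0(2)[OF that] by (simp add: c_def f_def)
    have upper: "f a z \<le> real m * c" if "z \<in> sphere 0 1" for z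
      unfolding f_def by (rule basis_upper_bound[OF e lower that])
    have mc: "1 \<le> real m * c"
      by (rule basis_lower_bound[OF e a1 lower])
    then have c: "c > 0" using m by (smt (verit) mult_nonneg_nonpos of_nat_0_le_iff)
    have vertex_value: "f a (p l) \<le> - c / 2" if l: "wt a l > 0" for l
    proof -
      have "\<phi> a l > 0" using l total_pos[OF a] by (simp add: wt_def zero_less_divide_iff)
      then have near: "\<bar>real R * a k - real_of_int ((vs ! l) k)\<bar> < 1" if "k < m" for k
        using that by (simp add: \<phi>_def kuhn_weight_pos_iff)
      have near': "\<bar>a k - vert l k\<bar> \<le> 1 / real R" if "k < m" for k
      proof -
        have "real R * \<bar>a k - vert l k\<bar> = \<bar>real R * a k - real_of_int ((vs ! l) k)\<bar>"
          using R by (simp add: vert_def abs_mult_pos' algebra_simps flip: abs_mult_pos)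
        then show ?thesis using near[OF that] R by (simp add: field_simps)
      qed
      have diff: "\<bar>f a z - f (vert l) z\<bar> \<le> 1 / (4 * real m)" if z: "z \<in> sphere 0 1" for z
      proof -
        have "\<bar>f a z - f (vert l) z\<bar> = \<bar>\<Sum>k<m. (a k - vert l k) * e k z\<bar>"
          by (simp add: f_def left_diff_distrib sum_subtractf)
        also have "\<dots> \<le> (\<Sum>k<m. \<bar>(a k - vert l k) * e k z\<bar>)" by (rule sum_abs)
        also have "\<dots> \<le> (\<Sum>k<m. 1 / real R * real m)"
          using near' e_le z by (intro sum_mono) (simp only: abs_mult, intro mult_mono; simp)
        also have "\<dots> = 1 / (4 * real m)"
          using m by (simp add: R_def field_simps power3_eq_cube power2_eq_square)
        finally show ?thesis .
      qed
      have "f a (p l) \<le> f (vert l) (p l) + 1 / (4 * real m)" using diff[OF p[of l]] by linarith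
      also have "\<dots> \<le> f (vert l) x0 + 1 / (4 * real m)" using p_min[OF x0(1)] by simp
      also have "\<dots> \<le> f a x0 + 2 * (1 / (4 * real m))" using diff[OF x0(1)] by linarith
      also have "\<dots> \<le> - c / 2"
        using mc m by (simp add: c_def field_simps)
      finally show ?thesis .
    qed
    obtain B where B: "B \<subseteq> {..<N}" "card B \<le> card {l. l < n \<and> wt a l > 0}"
      "\<And>i. i \<in> {..<N} - B \<Longrightarrow> \<exists>l<n. wt a l > 0 \<and> pos a i = real l"
      using quantile_positions[where w = "wt a" and n = n and N = N, OF wt0 wt1[OF a]]
      unfolding pos_def by blast
    have finB: "finite B" using B(1) finite_subset by blast
    have cardB: "real (card B) \<le> real m + 1" using B(2) support[OF a] by linarith
    have good: "f a (\<gamma> (pos a i)) \<le> - c / 2" if i: "i \<in> {..<N} - B" for i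
    proof -
      obtain l where "l < n" "wt a l > 0" "pos a i = real l" using B(3)[OF i] by blast
      then show ?thesis using vertex_value \<gamma>_p[of l] by simp
    qed
    have "(\<Sum>i<N. f a (\<gamma> (pos a i)))
        = (\<Sum>i\<in>{..<N} - B. f a (\<gamma> (pos a i))) + (\<Sum>i\<in>B. f a (\<gamma> (pos a i)))"
      using B(1) by (simp add: sum.subset_diff)
    also have "\<dots> \<le> (\<Sum>i\<in>{..<N} - B. - c / 2) + (\<Sum>i\<in>B. real m * c)"
      using good upper[OF \<gamma>_sphere] by (intro add_mono sum_mono)
    also have "\<dots> = (real N - real (card B)) * (- c / 2) + real (card B) * (real m * c)"
      using B(1) finB card_mono[OF _ B(1)] by (simp add: card_Diff_subset of_nat_diff)
    also have "\<dots> = - (real N * c / 2) + real (card B) * (c / 2 + real m * c)"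
      by (simp add: algebra_simps)
    also have "\<dots> \<le> - (real N * c / 2) + (real m + 1) * (c / 2 + real m * c)"
      using cardB c by (intro add_left_mono mult_right_mono) auto
    finally have sumX: "(\<Sum>i<N. f a (\<gamma> (pos a i)))
        \<le> - (real N * c / 2) + (real m + 1) * (c / 2 + real m * c)" .
    have "(\<Sum>y\<in>#Y. f a y) \<le> (\<Sum>y\<in>#Y. real m * c)"
      using Y upper by (intro sum_mset_mono) auto
    then have sumY: "(\<Sum>y\<in>#Y. f a y) \<le> real (size Y) * (real m * c)" by simp
    have "(\<Sum>k<m. a k * F a k) = (\<Sum>i<N. f a (\<gamma> (pos a i))) + (\<Sum>y\<in>#Y. f a y)"
    proof -
      have "(\<Sum>k<m. a k * (\<Sum>y\<in>#Y. e k y)) = (\<Sum>y\<in>#Y. f a y)"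
        unfolding f_def by (induction Y) (simp_all add: distrib_left sum.distrib)
      moreover have "(\<Sum>k<m. a k * (\<Sum>i<N. e k (\<gamma> (pos a i)))) = (\<Sum>i<N. f a (\<gamma> (pos a i)))"
        unfolding f_def sum_distrib_left by (rule sum.swap)
      ultimately show ?thesis by (simp add: F_def distrib_left sum.distrib)
    qed
    also have "\<dots> \<le> - (real N * c / 2) + (real m + 1) * (c / 2 + real m * c)
        + real (size Y) * (real m * c)"
      using sumX sumY by (rule add_mono)
    also have "\<dots> = - (c / 2) *
        (real N - ((real m + 1) + 2 * real m * (real m + 1 + real (size Y))))"
      by (simp add: field_simps)
    also have "\<dots> < 0"
    proof (intro mult_neg_pos)
      have "real N > real ((m + 1) + 2 * m * (m + 1 + size Y))"
        using N by (simp only: of_nat_less_iff)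
      then show "real N - ((real m + 1) + 2 * real m * (real m + 1 + real (size Y))) > 0"
        by (simp add: algebra_simps)
    qed (use c in simp)
    finally show "(\<Sum>k<m. a k * F a k) < 0" .
  qed
  then obtain a where a: "\<And>k. k < m \<Longrightarrow> F a k = 0" by blast
  show ?thesis
  proof (intro exI[of _ "image_mset (\<lambda>i. \<gamma> (pos a i)) (mset_set {..<N})"] conjI allI impI)
    fix k assume "k < m"
    from a[OF this] show "(\<Sum>x\<in>#image_mset (\<lambda>i. \<gamma> (pos a i)) (mset_set {..<N}). e k x)
        + (\<Sum>y\<in>#Y. e k y) = 0"
      by (simp add: F_def sum_unfold_sum_mset image_mset.compositionality comp_def)
  qed (use \<gamma>_sphere in auto)
qed

lemma spherical_design_of_basis:
  fixes e :: "nat \<Rightarrow> real ^ 'n::finite \<Rightarrow> real"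
  assumes e: "mean_zero_basis t m e" and Z: "Z \<noteq> {#}" "set_mset Z \<subseteq> sphere 0 1"
    and zero: "\<And>k. k < m \<Longrightarrow> (\<Sum>z\<in>#Z. e k z) = 0"
  shows "spherical_design t Z"
  unfolding spherical_design_def
proof (intro conjI allI impI Z)
  fix p :: "'n real_mpoly" assume "mpoly_degree p \<le> t"
  then have p: "poly_fun t (mpoly_eval p)" by (rule poly_fun_mpoly_eval)
  define I where "I = sphere_integral (mpoly_eval p)"
  have int: "integrable sphere_measure g" if "poly_fun t g" for g :: "real ^ 'n \<Rightarrow> real"
    using that by (intro sphere_integrable_continuous poly_fun_continuous)
  have "poly_fun t (\<lambda>x. mpoly_eval p x + (- I))"
    by (rule poly_fun.add[OF p poly_fun.const])
  moreover have "sphere_integral (\<lambda>x. mpoly_eval p x + (- I)) = 0"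
    unfolding Bochner_Integration.integral_add[OF int[OF p] int[OF poly_fun.const]]
      sphere_integral_const by (simp add: I_def)
  ultimately obtain c where "\<And>x. x \<in> sphere 0 1 \<Longrightarrow> mpoly_eval p x + (- I) = (\<Sum>k<m. c k * e k x)"
    using e unfolding mean_zero_basis_def by blast
  then have c: "mpoly_eval p x = I + (\<Sum>k<m. c k * e k x)" if "x \<in> sphere 0 1" for x
    using that by (simp add: algebra_simps)
  have "(\<Sum>z\<in>#Z. mpoly_eval p z) = (\<Sum>z\<in>#Z. I + (\<Sum>k<m. c k * e k z))"
    using c Z(2) by (intro arg_cong[where f = sum_mset] image_mset_cong) auto
  also have "\<dots> = real (size Z) * I + (\<Sum>k<m. c k * (\<Sum>z\<in>#Z. e k z))"
    by (induction Z) (simp_all add: algebra_simps sum.distrib)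
  also have "\<dots> = real (size Z) * I" using zero by simp
  finally show "sphere_integral (mpoly_eval p) = (\<Sum>z\<in>#Z. mpoly_eval p z) / real (size Z)"
    using Z(1) by (simp add: I_def)
qed

theorem corollary2:
  fixes d :: nat and c1 c2 :: real
  assumes "CARD('n::finite) = d + 1" and "d \<ge> 1" and "c1 > 0" and "c2 > 0"
  shows "\<exists>C>0. \<forall>t1 t. \<forall>Y :: (real ^ 'n) multiset.
    1 \<le> t1 \<and> t1 < t \<and> spherical_design t1 Y \<and>
    c1 * real t1 ^ d \<le> real (size Y) \<and> real (size Y) \<le> c2 * real t1 ^ d \<longrightarrow>
    (\<exists>N\<ge>1. \<exists>X :: (real ^ 'n) multiset.
       size X = N \<and> set_mset X \<subseteq> sphere 0 1 \<and>
       real (N + size Y) \<le> C * real t ^ (2 * d + 1) \<and>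
       spherical_design t (X + Y))"
proof -
  \<comment> \<open>The dimension is at most \<open>2 * (t + 1) ^ d \<le> A * t ^ d\<close>; \<open>C\<close> collects the coefficients of
    \<open>N + size Y\<close> as a quadratic expression in \<open>t ^ d\<close>.\<close>
  define A :: real where "A = 2 * 2 ^ d"
  define C where "C = A + 2 + 2 * A * (A + 1 + c2) + c2"
  have A: "A > 0" by (simp add: A_def)
  have C: "C > 0" using A \<open>c2 > 0\<close> by (simp add: C_def add_pos_pos)
  show ?thesis
  proof (intro exI[of _ C] conjI C allI impI)
    fix t1 t and Y :: "(real ^ 'n) multiset"
    assume *: "1 \<le> t1 \<and> t1 < t \<and> spherical_design t1 Y \<and>
      c1 * real t1 ^ d \<le> real (size Y) \<and> real (size Y) \<le> c2 * real t1 ^ d"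
    then have t: "t1 \<ge> 1" "t1 < t" and Y: "Y \<noteq> {#}" "set_mset Y \<subseteq> sphere 0 1"
      by (auto simp: spherical_design_def)
    define T where "T = real t ^ d"
    have T1: "T \<ge> 1" using t by (simp add: T_def)
    have "c2 * real t1 ^ d \<le> c2 * T"
      unfolding T_def using t \<open>c2 > 0\<close> by (intro mult_left_mono power_mono) auto
    then have M: "real (size Y) \<le> c2 * T" using * by linarith
    obtain m and e :: "nat \<Rightarrow> real ^ 'n \<Rightarrow> real"
      where m: "m \<le> 2 * (t + 1) ^ d" and e: "mean_zero_basis t m e"
      using mean_zero_basis_exists[where 'n = 'n, of t] assms(1) by auto
    have "real m \<le> 2 * real (t + 1) ^ d"
      using m of_nat_mono[OF m, where 'a = real] by simp
    also have "\<dots> \<le> 2 * (2 * real t) ^ d"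
      using t by (intro mult_left_mono power_mono) auto
    finally have m': "real m \<le> A * T" by (simp add: A_def T_def power_mult_distrib)
    define N where "N = (m + 1) + 2 * m * (m + 1 + size Y) + 1"
    obtain X :: "(real ^ 'n) multiset" where X: "size X = N" "set_mset X \<subseteq> sphere 0 1"
      and zero: "\<And>k. k < m \<Longrightarrow> (\<Sum>x\<in>#X. e k x) + (\<Sum>y\<in>#Y. e k y) = 0"
      using prescribed_nodes_exist[OF _ e Y(2), of N] assms(1,2) by (auto simp: N_def)
    have "spherical_design t (X + Y)"
      using X(2) Y zero by (intro spherical_design_of_basis[OF e]) auto
    moreover have "real (N + size Y) \<le> C * real t ^ (2 * d + 1)"
    proof -
      have TT: "T \<le> T * T" "1 \<le> T * T"
        using mult_left_mono[OF T1, of T] mult_mono[OF T1 T1] T1 by simp_all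
      have "real (N + size Y) = real m + 2 + 2 * (real m * (real m + 1 + real (size Y))) + real (size Y)"
        by (simp add: N_def algebra_simps)
      also have "\<dots> \<le> A * T + 2 + 2 * ((A * T) * (A * T + T + c2 * T)) + c2 * T"
        using m' M T1 A by (intro add_mono mult_left_mono mult_mono) auto
      also have "\<dots> \<le> A * (T * T) + 2 * (T * T) + 2 * ((A * T) * (A * T + T + c2 * T)) + c2 * (T * T)"
      proof -
        have "A * T \<le> A * (T * T)" "c2 * T \<le> c2 * (T * T)"
          using TT(1) A \<open>c2 > 0\<close> by (intro mult_left_mono; simp)+
        then show ?thesis using TT(2) by linarith
      qed
      also have "\<dots> = C * (T * T)"
        by (simp add: C_def algebra_simps)
      also have "T * T = real t ^ (2 * d)"
        by (simp add: T_def mult_2 power_add)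
      also have "C * \<dots> \<le> C * real t ^ (2 * d + 1)"
        using C t by (intro mult_left_mono power_increasing) auto
      finally show ?thesis .
    qed
    ultimately show "\<exists>N\<ge>1. \<exists>X :: (real ^ 'n) multiset.
       size X = N \<and> set_mset X \<subseteq> sphere 0 1 \<and>
       real (N + size Y) \<le> C * real t ^ (2 * d + 1) \<and>
       spherical_design t (X + Y)"
      using X by (intro exI[of _ N] conjI exI[of _ X]) (auto simp: N_def)
  qed
qed

end
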